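(* Let $k\geq a\geq 1$ be integers with $k\not\equiv a \pmod 2$. Then \[ \sum_{n_1, n_2, \ldots, n_{k-1}\geq 0} \frac{q^{N_1^2+N_2^2+\cdots+N_{k-1}^2+2N_a+2N_{a+2}+\cdots+2N_{k-1}}\,(-q;q^2)_{n_{k-1}}} {(q^2;q^2)_{n_1}(q^2;q^2)_{n_2}\cdots(q^2;q^2)_{n_{k-2}}(q^4;q^4)_{n_{k-1}}} =\frac{(-q;q^2)_{\infty}\,(q^a,q^{2k+2-a},q^{2k+2};q^{2k+2})_{\infty}}{(q^2;q^2)_{\infty}}, \] where $N_i=n_i+n_{i+1}+\cdots+n_{k-1}$ for $1\le i\le k-1$ (so $n_i=N_i-N_{i+1}$ with $N_k=0$).
   Context: Standard $q$-series notation: $(a;q)_\infty=\prod_{j\ge0}(1-aq^j)$, $(a;q)_n=(a;q)_\infty/(aq^n;q)_\infty$, and $(a_1,\ldots,a_m;q)_\infty=(a_1;q)_\infty\cdots(a_m;q)_\infty$. The identity is one of formal power series in $q$ (equivalently, of analytic functions for $|q|<1$). Since $k-1\equiv a \pmod 2$, the linear terms in the exponent are $2N_j$ for $j=a,a+2,\ldots,k-1$. *)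

theory Defs
  imports "HOL-Analysis.Analysis"
begin

definition qpoch_inf :: "complex \<Rightarrow> complex \<Rightarrow> complex" where
  "qpoch_inf a q = (\<Prod>j. 1 - a * q ^ j)"

text \<open>
  The finite symbol is the quotient of infinite ones. This is meaningful as long as
  the denominator does not vanish; see \<open>qpoch_eq_prod\<close> below.
\<close>

definition qpoch :: "complex \<Rightarrow> complex \<Rightarrow> nat \<Rightarrow> complex" where
  "qpoch a q n = qpoch_inf a q / qpoch_inf (a * q ^ n) q"

definition qpoch_inf_list :: "complex list \<Rightarrow> complex \<Rightarrow> complex" where
  "qpoch_inf_list as q = (\<Prod>a\<leftarrow>as. qpoch_inf a q)"

definition Nsum :: "nat \<Rightarrow> (nat \<Rightarrow> nat) \<Rightarrow> nat \<Rightarrow> nat" where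
  "Nsum k n i = (\<Sum>j = i..k-1. n j)"

lemma convergent_prod_qpoch:
  assumes "norm q < 1"
  shows "convergent_prod (\<lambda>j. 1 - a * q ^ j :: complex)"
proof -
  have "summable (\<lambda>j. norm a * norm q ^ j)"
    using assms by (intro summable_mult summable_geometric) auto
  then have "summable (\<lambda>j. norm ((1 - a * q ^ j) - 1))"
    by (simp add: norm_mult norm_power)
  then show ?thesis
    by (intro abs_convergent_prod_imp_convergent_prod summable_imp_abs_convergent_prod)
qed

lemma qpoch_eq_prod:
  assumes q: "norm q < 1" and nz: "\<And>j. j \<ge> n \<Longrightarrow> a * q ^ j \<noteq> 1"
  shows "qpoch a q n = (\<Prod>j<n. 1 - a * q ^ j)"
proof -
  have tail: "qpoch_inf (a * q ^ n) q = (\<Prod>j. 1 - a * q ^ (j + n))"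
    by (simp add: qpoch_inf_def power_add mult_ac)
  have nz': "qpoch_inf (a * q ^ n) q \<noteq> 0"
    unfolding tail
  proof (rule prodinf_nonzero)
    show "convergent_prod (\<lambda>j. 1 - a * q ^ (j + n))"
      using convergent_prod_qpoch[OF q, of a] by (subst convergent_prod_iff_shift)
    show "1 - a * q ^ (j + n) \<noteq> 0" for j
      using nz[of "j + n"] by simp
  qed
  have "qpoch_inf a q = (\<Prod>j<n. 1 - a * q ^ j) * qpoch_inf (a * q ^ n) q"
    unfolding tail unfolding qpoch_inf_def
    using has_prod_ignore_initial_segment'[OF convergent_prod_qpoch[OF q], of a n]
    by (rule has_prod_unique[symmetric])
  with nz' show ?thesis by (simp add: qpoch_def)
qed

end

theory Submission
  imports Defs
begin

text \<open>
  With \<open>P(n) = 1/(q\<^sup>2;q\<^sup>2)\<^sub>n\<close> and \<open>P(n) = 0\<close> for \<open>n < 0\<close>, this is a Bailey chain argument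
  for sums of the form \<open>\<Sum>\<^sub>j c\<^sub>j P(N-j) P(N+j)\<close>. Summing against \<open>(-q;q\<^sup>2)\<^sub>s q^(s\<^sup>2) P(N-s)\<close> or
  \<open>(-q;q\<^sup>2)\<^sub>s q^(s\<^sup>2+2s) P(N-s)\<close> reproduces the shape with new coefficients \<open>c\<^sub>j\<close>, up to
  the factor \<open>(-q;q\<^sup>2)\<^sub>N\<close>, which is what the next summation needs; both are cases of the
  \<open>q\<close>-Chu-Vandermonde sum. The step with the linear exponent requires \<open>q^(2j) c\<^sub>j\<close> to be antisymmetric
  under \<open>j \<mapsto> -1-j\<close>, and the alternation of the two steps is exactly what restores this property.
  The chain starts from \<open>1/(q\<^sup>4;q\<^sup>4)\<^sub>n\<close>, with \<open>c\<^sub>j = (-1)^j q^(2j\<^sup>2)\<close>, and ends in a truncated theta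
  series, which the Jacobi triple product evaluates in the limit.
\<close>

section \<open>Finite q-products and the q-Chu-Vandermonde sum\<close>

definition qprod :: "complex \<Rightarrow> complex \<Rightarrow> nat \<Rightarrow> complex" where
  "qprod a q n = (\<Prod>j<n. 1 - a * q ^ j)"

text \<open>The value 0 at negative integers lets summation ranges be enlarged freely and shifted
  arguments such as \<open>N - j\<close> be used without side conditions.\<close>

definition rfac :: "complex \<Rightarrow> int \<Rightarrow> complex" where
  "rfac q n = (if n < 0 then 0 else inverse (qprod q q (nat n)))"

lemma qprod_0 [simp]: "qprod a q 0 = 1"
  by (simp add: qprod_def)

lemma qprod_0_left [simp]: "qprod 0 q n = 1"
  by (simp add: qprod_def)

lemma qprod_Suc: "qprod a q (Suc n) = qprod a q n * (1 - a * q ^ n)"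
  by (simp add: qprod_def)

lemma qprod_Suc_left: "qprod a q (Suc n) = (1 - a) * qprod (a * q) q n"
  by (simp add: qprod_def prod.lessThan_Suc_shift mult_ac del: prod.lessThan_Suc)

lemma qprod_add: "qprod a q (m + n) = qprod a q m * qprod (a * q ^ m) q n"
  by (induction n) (simp_all add: qprod_Suc power_add mult_ac)

lemma one_minus_power_nz:
  fixes q :: complex
  assumes "norm q < 1" "n > 0"
  shows "1 - q ^ n \<noteq> 0"
proof
  assume "1 - q ^ n = 0"
  then have "norm q ^ n = 1" by (simp flip: norm_power)
  moreover have "norm q ^ n < 1" using assms by (simp add: power_less_one_iff)
  ultimately show False by simp
qed

lemma qprod_nz:
  assumes "norm q < 1"
  shows "qprod q q n \<noteq> 0"
  using one_minus_power_nz[OF assms, of "Suc _"] by (simp add: qprod_def)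

lemma rfac_neg [simp]: "n < 0 \<Longrightarrow> rfac q n = 0"
  by (simp add: rfac_def)

lemma rfac_of_nat: "rfac q (int n) = inverse (qprod q q n)"
  by (simp add: rfac_def)

lemma rfac_0 [simp]: "rfac q 0 = 1"
  by (simp add: rfac_def)

text \<open>The convention at negative integers makes the recurrence valid for every integer: at
  \<open>n = 0\<close> the factor \<open>1 - q powi 0\<close> vanishes together with
  \<open>rfac q (-1)\<close>.\<close>

lemma rfac_rec:
  assumes "norm q < 1"
  shows "(1 - q powi n) * rfac q n = rfac q (n - 1)"
proof (cases "n > 0")
  case True
  then obtain m where n: "n = int (Suc m)" by (metis gr0_implies_Suc zero_less_imp_eq_int)
  have "1 - q ^ Suc m \<noteq> 0" using one_minus_power_nz[OF assms, of "Suc m"] by simp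
  moreover have "rfac q (n - 1) = inverse (qprod q q m)" by (simp add: n rfac_of_nat)
  moreover have "rfac q n = inverse (qprod q q m * (1 - q ^ Suc m))"
    unfolding n rfac_of_nat by (simp add: qprod_Suc)
  moreover have "q powi n = q ^ Suc m" unfolding n by (rule power_int_of_nat)
  ultimately show ?thesis by (simp add: inverse_mult_distrib)
next
  case False
  then show ?thesis by (cases "n = 0") simp_all
qed

lemma rfac_rec_nat:
  assumes "norm q < 1"
  shows "(1 - q ^ n) * rfac q (int n) = rfac q (int n - 1)"
  using rfac_rec[OF assms, of "int n"] by simp

text \<open>This is the sum of 2phi1(q^(-n), b; be; q, e q^n), multiplied by (be;q)_n / (q;q)_n so
  that no denominator in b or e occurs. The induction lets \<open>e\<close> vary, since the step
  from n to n + 1 replaces \<open>e\<close> by \<open>e * q\<close>. For \<open>b = 0\<close> it is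
  the finite q-binomial theorem.\<close>

lemma q_vandermonde:
  assumes q: "norm q < 1"
  shows "(\<Sum>r\<le>n. rfac q (int r) * rfac q (int n - int r) * (- e) ^ r * q ^ (r choose 2)
            * qprod b q r * qprod (b * e * q ^ r) q (n - r)) = qprod e q n * rfac q (int n)"
proof (induction n arbitrary: e)
  case 0
  then show ?case by (simp add: numeral_2_eq_2)
next
  case (Suc n)
  define X where "X r = (- e) ^ r * q ^ (r choose 2) * qprod b q r * qprod (b * e * q ^ r) q (Suc n - r)" for r
  define A where "A r = q ^ r * rfac q (int r) * rfac q (int n - int r) * X r" for r
  define B where "B r = rfac q (int r - 1) * rfac q (int (Suc n) - int r) * X r" for r
  \<comment> \<open>Split 1 - q^(n+1) = q^r (1 - q^(n+1-r)) + (1 - q^r); each part lowers the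
    argument of one of the two \<open>rfac\<close> factors.\<close>
  have AB: "(1 - q ^ Suc n) * (rfac q (int r) * rfac q (int (Suc n) - int r) * X r) = A r + B r"
    if "r \<le> Suc n" for r
  proof -
    have s: "int (Suc n) - int r = int (Suc n - r)" "int n - int r = int (Suc n - r) - 1"
      using that by simp_all
    have p: "q ^ Suc n = q ^ r * q ^ (Suc n - r)"
      using that by (simp flip: power_add)
    show ?thesis
      unfolding A_def B_def s(2) unfolding s(1) p rfac_rec_nat[OF q, symmetric]
      by (simp add: algebra_simps)
  qed
  \<comment> \<open>Pairing \<open>A r\<close> with the next \<open>B\<close> restores the summand
    for n, with \<open>e * q\<close> in place of \<open>e\<close>.\<close>
  have AB': "A r + B (Suc r) = (1 - e) * (rfac q (int r) * rfac q (int n - int r) * (- (e * q)) ^ r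
       * q ^ (r choose 2) * qprod b q r * qprod (b * (e * q) * q ^ r) q (n - r))" if "r \<le> n" for r
  proof -
    have 1: "qprod (b * e * q ^ r) q (Suc n - r) = (1 - b * e * q ^ r) * qprod (b * (e * q) * q ^ r) q (n - r)"
      using that by (simp add: Suc_diff_le qprod_Suc_left mult_ac)
    have 2: "Suc r choose 2 = r + (r choose 2)" by (simp add: numeral_2_eq_2)
    have 3: "(- (e * q)) ^ r = (- e) ^ r * q ^ r"
      by (metis mult_minus_left power_mult_distrib)
    have 4: "b * e * q ^ Suc r = b * (e * q) * q ^ r" by simp
    show ?thesis
      unfolding A_def B_def X_def 1 2 3 unfolding 4 qprod_Suc by (simp add: power_add algebra_simps)
  qed
  have "(1 - q ^ Suc n) * (\<Sum>r\<le>Suc n. rfac q (int r) * rfac q (int (Suc n) - int r) * X r)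
      = (\<Sum>r\<le>Suc n. A r + B r)"
    unfolding sum_distrib_left by (rule sum.cong) (use AB in auto)
  also have "\<dots> = (\<Sum>r\<le>Suc n. A r) + (\<Sum>r\<le>Suc n. B r)"
    by (rule sum.distrib)
  also have "(\<Sum>r\<le>Suc n. A r) = (\<Sum>r\<le>n. A r)"
    by (simp add: A_def)
  also have "(\<Sum>r\<le>Suc n. B r) = (\<Sum>r\<le>n. B (Suc r))"
    by (subst sum.atMost_Suc_shift) (simp add: B_def)
  also have "(\<Sum>r\<le>n. A r) + (\<Sum>r\<le>n. B (Suc r)) = (\<Sum>r\<le>n. A r + B (Suc r))"
    by (rule sum.distrib[symmetric])
  also have "\<dots> = (1 - e) * (qprod (e * q) q n * rfac q (int n))"
    unfolding Suc.IH[symmetric] sum_distrib_left by (rule sum.cong) (use AB' in auto)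
  also have "\<dots> = (1 - q ^ Suc n) * (qprod e q (Suc n) * rfac q (int (Suc n)))"
    using rfac_rec_nat[OF q, of "Suc n"] by (simp add: qprod_Suc_left mult_ac)
  finally have "(\<Sum>r\<le>Suc n. rfac q (int r) * rfac q (int (Suc n) - int r) * X r)
      = qprod e q (Suc n) * rfac q (int (Suc n))"
    using one_minus_power_nz[OF q, of "Suc n"] by (metis mult_left_cancel zero_less_Suc)
  then show ?case
    unfolding X_def by (simp only: mult.assoc)
qed

text \<open>Only s from j to N contribute, and s = r + j turns the sum into
  \<open>q_vandermonde\<close> to the base q^2. The cases t = 0 and t = 1 are the kernels of the two
  chain steps.\<close>

lemma bailey_kernel_sum_nat:
  fixes N j t :: nat
  assumes q: "norm q < 1"
  shows "(\<Sum>s\<le>N. qprod (- q) (q\<^sup>2) s * q ^ (s\<^sup>2 + 2 * t * s) * rfac (q\<^sup>2) (int N - int s)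
            * rfac (q\<^sup>2) (int s - int j) * rfac (q\<^sup>2) (int s + int j + int t))
       = q ^ (j\<^sup>2 + 2 * t * j) * qprod (- q) (q\<^sup>2) j * qprod (- (q ^ (2 * j + 1 + 2 * t))) (q\<^sup>2) (N - j)
            * rfac (q\<^sup>2) (int N - int j) * rfac (q\<^sup>2) (int N + int j + int t)" (is "sum ?f _ = ?R")
proof (cases "j \<le> N")
  case False
  then have "?f s = 0" if "s \<le> N" for s using that by simp
  then have "sum ?f {..N} = 0" by (intro sum.neutral) auto
  then show ?thesis using False by simp
next
  case True
  define n where "n = N - j"
  have N: "N = n + j" using True by (simp add: n_def)
  have q2: "norm (q\<^sup>2) < 1" using q by (simp add: norm_power power_less_one_iff)
  \<comment> \<open>(b;q^2)_r is what remains of (-q;q^2)_(r+j) after its first j factors, and -e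
    collects the part of the power of q that is linear in r. Their product is a power of q^2, so the
    last factor in \<open>q_vandermonde\<close> is a quotient of two products (q^2;q^2).\<close>
  define b where "b = - (q ^ (2 * j + 1))"
  define e where "e = - (q ^ (2 * j + 1 + 2 * t))"
  have be: "b * e = (q\<^sup>2) ^ (2 * j + t + 1)"
    by (simp add: b_def e_def flip: power_mult power_add)
  have "sum ?f {..N} = sum ?f {j..N}"
    by (rule sum.mono_neutral_right) auto
  also have "\<dots> = (\<Sum>r\<le>n. ?f (r + j))"
    using sum.shift_bounds_cl_nat_ivl[of ?f 0 j n] unfolding N by (simp only: atLeast0AtMost add_0)
  also have "\<dots> = (\<Sum>r\<le>n. q ^ (j\<^sup>2 + 2 * t * j) * qprod (- q) (q\<^sup>2) j * rfac (q\<^sup>2) (int N + int j + int t) *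
       (rfac (q\<^sup>2) (int r) * rfac (q\<^sup>2) (int n - int r) * (- e) ^ r * (q\<^sup>2) ^ (r choose 2)
            * qprod b (q\<^sup>2) r * qprod (b * e * (q\<^sup>2) ^ r) (q\<^sup>2) (n - r)))"
  proof (rule sum.cong)
    fix r assume "r \<in> {..n}"
    then have r: "r \<le> n" by simp
    have 1: "qprod (- q) (q\<^sup>2) (r + j) = qprod (- q) (q\<^sup>2) j * qprod b (q\<^sup>2) r"
      by (subst add.commute, subst qprod_add) (simp add: b_def flip: power_mult)
    have c2: "2 * (r choose 2) + r = r\<^sup>2"
      by (induction r) (simp_all add: numeral_2_eq_2)
    have 2: "q ^ ((r + j)\<^sup>2 + 2 * t * (r + j)) = q ^ (j\<^sup>2 + 2 * t * j) * ((- e) ^ r * (q\<^sup>2) ^ (r choose 2))"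
      unfolding e_def minus_minus power_mult[symmetric] power_add[symmetric]
      by (rule arg_cong[where f = "power q"]) (simp add: c2[symmetric] power2_sum algebra_simps)
    have "qprod (q\<^sup>2) (q\<^sup>2) (n + 2 * j + t) = qprod (q\<^sup>2) (q\<^sup>2) (r + 2 * j + t) * qprod (b * e * (q\<^sup>2) ^ r) (q\<^sup>2) (n - r)"
    proof -
      have "r + 2 * j + t + (n - r) = n + 2 * j + t" using r by simp
      moreover have "q\<^sup>2 * (q\<^sup>2) ^ (r + 2 * j + t) = b * e * (q\<^sup>2) ^ r"
        unfolding be by (simp add: power_add mult_ac)
      ultimately show ?thesis by (metis qprod_add)
    qed
    then have 3: "rfac (q\<^sup>2) (int (r + j) + int j + int t) =
        rfac (q\<^sup>2) (int N + int j + int t) * qprod (b * e * (q\<^sup>2) ^ r) (q\<^sup>2) (n - r)"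
      using qprod_nz[OF q2, of "n + 2 * j + t"] qprod_nz[OF q2, of "r + 2 * j + t"]
      by (simp add: rfac_def N field_simps nat_add_distrib nat_mult_distrib mult_2)
    have 4: "int N - int (r + j) = int n - int r" "int (r + j) - int j = int r" by (simp_all add: N)
    show "?f (r + j) = q ^ (j\<^sup>2 + 2 * t * j) * qprod (- q) (q\<^sup>2) j * rfac (q\<^sup>2) (int N + int j + int t) *
       (rfac (q\<^sup>2) (int r) * rfac (q\<^sup>2) (int n - int r) * (- e) ^ r * (q\<^sup>2) ^ (r choose 2)
            * qprod b (q\<^sup>2) r * qprod (b * e * (q\<^sup>2) ^ r) (q\<^sup>2) (n - r))"
      unfolding 1 2 3 4 by (simp only: mult_ac)
  qed simp
  also have "\<dots> = ?R"
    unfolding sum_distrib_left[symmetric] q_vandermonde[OF q2]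
    by (simp add: N e_def mult_ac)
  finally show ?thesis .
qed

section \<open>The Bailey chain\<close>

text \<open>For t = 0 the two products on the right of \<open>bailey_kernel_sum_nat\<close> join to
  (-q;q^2)_N, which does not depend on j. Both sides are even in j, which covers negative j.\<close>

lemma bailey_kernel_sum_0:
  fixes N :: nat and j :: int
  assumes q: "norm q < 1"
  shows "(\<Sum>s\<le>N. qprod (- q) (q\<^sup>2) s * q ^ (s\<^sup>2) * rfac (q\<^sup>2) (int N - int s)
            * rfac (q\<^sup>2) (int s - j) * rfac (q\<^sup>2) (int s + j))
       = qprod (- q) (q\<^sup>2) N * q powi (j\<^sup>2) * rfac (q\<^sup>2) (int N - j) * rfac (q\<^sup>2) (int N + j)"
    (is "?L j = ?R j")
proof -
  have nat: "?L (int m) = ?R (int m)" for m :: nat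
  proof (cases "m \<le> N")
    case True
    have "qprod (- q) (q\<^sup>2) N = qprod (- q) (q\<^sup>2) m * qprod (- (q ^ (2 * m + 1))) (q\<^sup>2) (N - m)"
      using qprod_add[of "- q" "q\<^sup>2" m "N - m"] True by (simp flip: power_mult)
    moreover have "q powi (int m)\<^sup>2 = q ^ m\<^sup>2"
      by (metis of_nat_power power_int_of_nat)
    ultimately show ?thesis
      using bailey_kernel_sum_nat[OF q, of 0 N m] by (simp add: mult_ac)
  next
    case False
    then show ?thesis using bailey_kernel_sum_nat[OF q, of 0 N m] by simp
  qed
  show ?thesis
  proof (cases j rule: int_cases2)
    case (nonneg m)
    then show ?thesis using nat by simp
  next
    case (nonpos m)
    then show ?thesis using nat[of m] by (simp add: mult_ac)
  qed
qed

text \<open>For t = 1 the two products leave out exactly the factor 1 + q^(2j+1); multiplying by it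
  completes them to (-q;q^2)_(N+1). Negative j are reached by the reflection j -> -1-j, which
  exchanges the two \<open>rfac\<close> factors depending on j.\<close>

lemma bailey_kernel_sum_1:
  fixes N :: nat and j :: int
  assumes q: "norm q < 1" "q \<noteq> 0"
  shows "(1 + q powi (2 * j + 1)) * (\<Sum>s\<le>N. qprod (- q) (q\<^sup>2) s * q ^ (s\<^sup>2 + 2 * s) * rfac (q\<^sup>2) (int N - int s)
            * rfac (q\<^sup>2) (int s - j) * rfac (q\<^sup>2) (int s + j + 1))
       = qprod (- q) (q\<^sup>2) (Suc N) * q powi (j\<^sup>2 + 2 * j) * rfac (q\<^sup>2) (int N - j) * rfac (q\<^sup>2) (int N + j + 1)"
    (is "_ * ?S j = ?R j")
proof -
  have nat: "(1 + q powi (2 * int m + 1)) * ?S (int m) = ?R (int m)" for m :: nat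
  proof (cases "m \<le> N")
    case True
    \<comment> \<open>The first product ends with 1 + q^(2m-1) and the last one starts with 1 +
      q^(2m+3).\<close>
    have "qprod (- q) (q\<^sup>2) (Suc N) = qprod (- q) (q\<^sup>2) m * ((1 + q powi (2 * int m + 1)) * qprod (- (q ^ (2 * m + 3))) (q\<^sup>2) (N - m))"
    proof -
      have e: "2 * int m + 1 = int (2 * m + 1)" by simp
      have "q powi (2 * int m + 1) = q ^ (2 * m + 1)" unfolding e by (rule power_int_of_nat)
      then have "(1 + q powi (2 * int m + 1)) * qprod (- (q ^ (2 * m + 3))) (q\<^sup>2) (N - m)
        = qprod (- (q ^ (2 * m + 1))) (q\<^sup>2) (Suc (N - m))"
        by (simp add: qprod_Suc_left power2_eq_square power3_eq_cube power_add mult_ac)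
      then show ?thesis
        using qprod_add[of "- q" "q\<^sup>2" m "Suc (N - m)"] True by (simp add: flip: power_mult)
    qed
    moreover have "q powi ((int m)\<^sup>2 + 2 * int m) = q ^ (m\<^sup>2 + 2 * m)"
    proof -
      have e: "(int m)\<^sup>2 + 2 * int m = int (m\<^sup>2 + 2 * m)" by simp
      show ?thesis unfolding e by (rule power_int_of_nat)
    qed
    moreover have "?S (int m) = q ^ (m\<^sup>2 + 2 * m) * qprod (- q) (q\<^sup>2) m * qprod (- (q ^ (2 * m + 3))) (q\<^sup>2) (N - m)
            * rfac (q\<^sup>2) (int N - int m) * rfac (q\<^sup>2) (int N + int m + 1)"
      using bailey_kernel_sum_nat[OF q(1), of 1 N m] by (simp add: eval_nat_numeral)
    ultimately show ?thesis by (simp only: mult_ac)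
  next
    case False
    then show ?thesis using bailey_kernel_sum_nat[OF q(1), of 1 N m] by simp
  qed
  show ?thesis
  proof (cases "j \<ge> 0")
    case True
    then show ?thesis using nat[of "nat j"] by simp
  next
    case False
    define m where "m = nat (- 1 - j)"
    have j: "j = - 1 - int m" using False by (simp add: m_def)
    have e: "x - j = x + int m + 1" "x + j + 1 = x - int m" for x
      by (simp_all add: j)
    have S: "?S j = ?S (int m)" unfolding e by (rule sum.cong) (simp_all only: mult_ac)
    \<comment> \<open>Here 2j + 1 = -(2m + 1), so multiplication by q^(2m+1) carries both sides at j
      to those at m.\<close>
    have 1: "q powi (2 * int m + 1) * (1 + q powi (2 * j + 1)) = 1 + q powi (2 * int m + 1)"
    proof -
      have "(2 * int m + 1) + (2 * j + 1) = 0" by (simp add: j)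
      then have "q powi (2 * int m + 1) * q powi (2 * j + 1) = 1"
        by (metis power_int_add power_int_0_right q(2))
      then show ?thesis by (simp add: algebra_simps)
    qed
    have "(2 * int m + 1) + (j\<^sup>2 + 2 * j) = (int m)\<^sup>2 + 2 * int m"
      by (simp add: j power2_eq_square algebra_simps)
    then have 2: "q powi (2 * int m + 1) * q powi (j\<^sup>2 + 2 * j) = q powi ((int m)\<^sup>2 + 2 * int m)"
      by (metis power_int_add q(2))
    have R: "q powi (2 * int m + 1) * ?R j = ?R (int m)"
      unfolding 2[symmetric] e by (simp only: mult_ac)
    have "q powi (2 * int m + 1) * ((1 + q powi (2 * j + 1)) * ?S j) = q powi (2 * int m + 1) * ?R j"
      unfolding R nat[symmetric] S 1[symmetric] by (simp only: mult_ac)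
    then show ?thesis using q(2) by simp
  qed
qed

text \<open>The beta side of a Bailey pair relative to 1, with coefficients spread over all
  integers: alpha_r is c_r + c_(-r) for r > 0. Outside the range one of the \<open>rfac\<close>
  factors vanishes.\<close>

definition bsum :: "complex \<Rightarrow> nat \<Rightarrow> (int \<Rightarrow> complex) \<Rightarrow> complex" where
  "bsum q N c = (\<Sum>j = - int N..int N. c j * rfac q (int N - j) * rfac q (int N + j))"

lemma bsum_superset:
  assumes "finite J" "{- int N..int N} \<subseteq> J"
  shows "bsum q N c = (\<Sum>j\<in>J. c j * rfac q (int N - j) * rfac q (int N + j))"
  unfolding bsum_def by (rule sum.mono_neutral_left) (use assms in \<open>auto simp: not_le\<close>)

lemma bailey_step_0:
  assumes q: "norm q < 1"
  shows "(\<Sum>s\<le>N. qprod (- q) (q\<^sup>2) s * q ^ (s\<^sup>2) * rfac (q\<^sup>2) (int N - int s) * bsum (q\<^sup>2) s c)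
       = qprod (- q) (q\<^sup>2) N * bsum (q\<^sup>2) N (\<lambda>j. c j * q powi (j\<^sup>2))"
proof -
  let ?J = "{- int N..int N}"
  have "(\<Sum>s\<le>N. qprod (- q) (q\<^sup>2) s * q ^ (s\<^sup>2) * rfac (q\<^sup>2) (int N - int s) * bsum (q\<^sup>2) s c)
     = (\<Sum>s\<le>N. \<Sum>j\<in>?J. c j * (qprod (- q) (q\<^sup>2) s * q ^ (s\<^sup>2) * rfac (q\<^sup>2) (int N - int s)
            * rfac (q\<^sup>2) (int s - j) * rfac (q\<^sup>2) (int s + j)))"
  proof (rule sum.cong)
    fix s assume "s \<in> {..N}"
    \<comment> \<open>The range of j is made independent of s, so that the two sums can be
      exchanged.\<close>
    then have "bsum (q\<^sup>2) s c = (\<Sum>j\<in>?J. c j * rfac (q\<^sup>2) (int s - j) * rfac (q\<^sup>2) (int s + j))"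
      by (intro bsum_superset) auto
    then show "qprod (- q) (q\<^sup>2) s * q ^ (s\<^sup>2) * rfac (q\<^sup>2) (int N - int s) * bsum (q\<^sup>2) s c
      = (\<Sum>j\<in>?J. c j * (qprod (- q) (q\<^sup>2) s * q ^ (s\<^sup>2) * rfac (q\<^sup>2) (int N - int s)
            * rfac (q\<^sup>2) (int s - j) * rfac (q\<^sup>2) (int s + j)))"
      by (simp add: sum_distrib_left mult_ac)
  qed simp
  also have "\<dots> = (\<Sum>j\<in>?J. c j * (\<Sum>s\<le>N. qprod (- q) (q\<^sup>2) s * q ^ (s\<^sup>2) * rfac (q\<^sup>2) (int N - int s)
            * rfac (q\<^sup>2) (int s - j) * rfac (q\<^sup>2) (int s + j)))"
    by (subst sum.swap) (simp add: sum_distrib_left)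
  also have "\<dots> = qprod (- q) (q\<^sup>2) N * bsum (q\<^sup>2) N (\<lambda>j. c j * q powi (j\<^sup>2))"
    unfolding bailey_kernel_sum_0[OF q] bsum_def sum_distrib_left by (simp only: mult_ac)
  finally show ?thesis .
qed

lemma sum_reflect:
  fixes f :: "int \<Rightarrow> complex"
  shows "2 * (\<Sum>j = - int N - 1..int N. f j) = (\<Sum>j = - int N - 1..int N. f j + f (- 1 - j))"
proof -
  have "(\<Sum>j = - int N - 1..int N. f (- 1 - j)) = (\<Sum>j = - int N - 1..int N. f j)"
    by (rule sum.reindex_bij_witness[of _ "\<lambda>j. - 1 - j" "\<lambda>j. - 1 - j"]) auto
  then show ?thesis by (simp add: sum.distrib)
qed

text \<open>The sum is centred at 0 but the antisymmetry at -1/2. Averaging the terms at j and -1-j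
  over an interval centred at -1/2 gives both the same factors
  \<open>rfac (s - j) * rfac (s + j + 1)\<close>, the kernel of \<open>bailey_kernel_sum_1\<close>.
  The range is governed by N rather than s, so that it is common to all s in an outer sum.\<close>

lemma bsum_antisym:
  assumes q: "norm q < 1" "q \<noteq> 0" and d: "\<And>j. d (- 1 - j) = - d j" and "s \<le> N"
  shows "2 * bsum (q\<^sup>2) s (\<lambda>j. d j * q powi (e j))
     = (\<Sum>j = - int N - 1..int N. d j * (q powi (e j) * (1 - q powi (2 * (int s + j + 1)))
           - q powi (e (- 1 - j)) * (1 - q powi (2 * (int s - j))))
           * rfac (q\<^sup>2) (int s - j) * rfac (q\<^sup>2) (int s + j + 1))"
proof -
  have q2: "norm (q\<^sup>2) < 1" using q by (simp add: norm_power power_less_one_iff)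
  have pw: "(q\<^sup>2) powi j = q powi (2 * j)" for j
    by (simp add: power_int_mult)
  let ?f = "\<lambda>j. d j * q powi (e j) * rfac (q\<^sup>2) (int s - j) * rfac (q\<^sup>2) (int s + j)"
  have "2 * bsum (q\<^sup>2) s (\<lambda>j. d j * q powi (e j)) = 2 * (\<Sum>j = - int N - 1..int N. ?f j)"
    using \<open>s \<le> N\<close> by (subst bsum_superset[of "{- int N - 1..int N}"]) auto
  also have "\<dots> = (\<Sum>j = - int N - 1..int N. ?f j + ?f (- 1 - j))"
    by (rule sum_reflect)
  also have "\<dots> = (\<Sum>j = - int N - 1..int N. d j * (q powi (e j) * (1 - q powi (2 * (int s + j + 1)))
           - q powi (e (- 1 - j)) * (1 - q powi (2 * (int s - j))))
           * rfac (q\<^sup>2) (int s - j) * rfac (q\<^sup>2) (int s + j + 1))"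
  proof (rule sum.cong)
    fix j
    have 1: "rfac (q\<^sup>2) (int s + j) = (1 - q powi (2 * (int s + j + 1))) * rfac (q\<^sup>2) (int s + j + 1)"
      using rfac_rec[OF q2, of "int s + j + 1"] unfolding pw by simp
    have 2: "rfac (q\<^sup>2) (int s + (- 1 - j)) = (1 - q powi (2 * (int s - j))) * rfac (q\<^sup>2) (int s - j)"
      using rfac_rec[OF q2, of "int s - j"] unfolding pw by (simp add: algebra_simps)
    have 3: "int s - (- 1 - j) = int s + j + 1" by simp
    have gen: "x * u * y * (v * z) + - x * u' * z * (v' * y) = x * (u * v - u' * v') * y * z"
      for x y z u v u' v' :: complex
      by (simp add: algebra_simps)
    show "?f j + ?f (- 1 - j) = d j * (q powi (e j) * (1 - q powi (2 * (int s + j + 1)))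
           - q powi (e (- 1 - j)) * (1 - q powi (2 * (int s - j))))
           * rfac (q\<^sup>2) (int s - j) * rfac (q\<^sup>2) (int s + j + 1)"
      unfolding 2 3 d unfolding 1 by (rule gen)
  qed simp
  finally show ?thesis .
qed

text \<open>Both sides are doubled and rewritten by \<open>bsum_antisym\<close>. The bracket on the
  left supplies the factor 1 + q^(2j+1) that \<open>bailey_kernel_sum_1\<close> consumes, and the
  one on the right supplies the last factor of (-q;q^2)_(N+1).\<close>

lemma bailey_step_1:
  assumes q: "norm q < 1" "q \<noteq> 0" and d: "\<And>j. d (- 1 - j) = - d j"
  shows "(\<Sum>s\<le>N. qprod (- q) (q\<^sup>2) s * q ^ (s\<^sup>2 + 2 * s) * rfac (q\<^sup>2) (int N - int s)
            * bsum (q\<^sup>2) s (\<lambda>j. d j * q powi (- 2 * j)))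
       = qprod (- q) (q\<^sup>2) N * bsum (q\<^sup>2) N (\<lambda>j. d j * q powi (j\<^sup>2))" (is "?L = ?R")
proof -
  let ?J = "{- int N - 1..int N}"
  have pw: "q powi i * q powi j = q powi (i + j)" for i j
    using q(2) by (simp add: power_int_add)
  have A: "2 * bsum (q\<^sup>2) s (\<lambda>j. d j * q powi (- 2 * j)) = (\<Sum>j\<in>?J. d j * q powi (- 2 * j) * (1 - q powi (2 * j + 1))
      * (1 + q powi (2 * j + 1)) * (rfac (q\<^sup>2) (int s - j) * rfac (q\<^sup>2) (int s + j + 1)))"
    if "s \<le> N" for s
    unfolding bsum_antisym[OF q, of d s N "\<lambda>j. - 2 * j", OF d that]
  proof (rule sum.cong)
    fix j
    \<comment> \<open>The terms containing s cancel, leaving q^(-2j) (1 - q^(4j+2)).\<close>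
    have "q powi (- 2 * j) * (1 - q powi (2 * (int s + j + 1))) - q powi (- 2 * (- 1 - j)) * (1 - q powi (2 * (int s - j)))
       = q powi (- 2 * j) * ((1 - q powi (2 * j + 1)) * (1 + q powi (2 * j + 1)))"
      by (simp add: right_diff_distrib left_diff_distrib distrib_left distrib_right pw) (simp add: algebra_simps)
    then show "d j * (q powi (- 2 * j) * (1 - q powi (2 * (int s + j + 1))) - q powi (- 2 * (- 1 - j)) * (1 - q powi (2 * (int s - j))))
         * rfac (q\<^sup>2) (int s - j) * rfac (q\<^sup>2) (int s + j + 1)
      = d j * q powi (- 2 * j) * (1 - q powi (2 * j + 1))
      * (1 + q powi (2 * j + 1)) * (rfac (q\<^sup>2) (int s - j) * rfac (q\<^sup>2) (int s + j + 1))"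
      by (simp only: mult.assoc)
  qed simp
  have B: "2 * bsum (q\<^sup>2) N (\<lambda>j. d j * q powi (j\<^sup>2)) = (\<Sum>j\<in>?J. d j * (1 - q powi (2 * j + 1)) * q powi (j\<^sup>2)
      * (1 + q ^ (2 * N + 1)) * (rfac (q\<^sup>2) (int N - j) * rfac (q\<^sup>2) (int N + j + 1)))"
    unfolding bsum_antisym[OF q, of d N N power2, OF d order_refl]
  proof (rule sum.cong)
    fix j
    have N: "q ^ (2 * N + 1) = q powi (2 * int N + 1)"
      using power_int_of_nat[of q "2 * N + 1"] by (simp add: add.commute)
    have "q powi (j\<^sup>2) * (1 - q powi (2 * (int N + j + 1))) - q powi ((- 1 - j)\<^sup>2) * (1 - q powi (2 * (int N - j)))
       = (1 - q powi (2 * j + 1)) * q powi (j\<^sup>2) * (1 + q ^ (2 * N + 1))"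
      unfolding N
      by (simp add: right_diff_distrib left_diff_distrib distrib_left distrib_right pw) (simp add: power2_eq_square algebra_simps)
    then show "d j * (q powi (j\<^sup>2) * (1 - q powi (2 * (int N + j + 1))) - q powi ((- 1 - j)\<^sup>2) * (1 - q powi (2 * (int N - j))))
         * rfac (q\<^sup>2) (int N - j) * rfac (q\<^sup>2) (int N + j + 1)
      = d j * (1 - q powi (2 * j + 1)) * q powi (j\<^sup>2)
      * (1 + q ^ (2 * N + 1)) * (rfac (q\<^sup>2) (int N - j) * rfac (q\<^sup>2) (int N + j + 1))"
      by (simp only: mult.assoc)
  qed simp
  let ?w = "\<lambda>s. qprod (- q) (q\<^sup>2) s * q ^ (s\<^sup>2 + 2 * s) * rfac (q\<^sup>2) (int N - int s)"
  have "2 * ?L = (\<Sum>s\<le>N. ?w s * (2 * bsum (q\<^sup>2) s (\<lambda>j. d j * q powi (- 2 * j))))"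
    by (simp add: sum_distrib_left mult_ac)
  also have "\<dots> = (\<Sum>s\<le>N. \<Sum>j\<in>?J. d j * q powi (- 2 * j) * (1 - q powi (2 * j + 1))
      * ((1 + q powi (2 * j + 1)) * (?w s * rfac (q\<^sup>2) (int s - j) * rfac (q\<^sup>2) (int s + j + 1))))"
  proof (rule sum.cong)
    fix s assume "s \<in> {..N}"
    then have s: "s \<le> N" by simp
    show "?w s * (2 * bsum (q\<^sup>2) s (\<lambda>j. d j * q powi (- 2 * j))) = (\<Sum>j\<in>?J. d j * q powi (- 2 * j) * (1 - q powi (2 * j + 1))
      * ((1 + q powi (2 * j + 1)) * (?w s * rfac (q\<^sup>2) (int s - j) * rfac (q\<^sup>2) (int s + j + 1))))"
      unfolding A[OF s] sum_distrib_left by (simp only: mult_ac)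
  qed simp
  also have "\<dots> = (\<Sum>j\<in>?J. d j * q powi (- 2 * j) * (1 - q powi (2 * j + 1)) * ((1 + q powi (2 * j + 1)) *
      (\<Sum>s\<le>N. ?w s * rfac (q\<^sup>2) (int s - j) * rfac (q\<^sup>2) (int s + j + 1))))"
    by (subst sum.swap) (simp only: sum_distrib_left)
  also have "\<dots> = (\<Sum>j\<in>?J. qprod (- q) (q\<^sup>2) N * (d j * (1 - q powi (2 * j + 1)) * q powi (j\<^sup>2)
      * (1 + q ^ (2 * N + 1)) * (rfac (q\<^sup>2) (int N - j) * rfac (q\<^sup>2) (int N + j + 1))))"
  proof (rule sum.cong)
    fix j
    have 1: "q powi (- 2 * j) * q powi (j\<^sup>2 + 2 * j) = q powi (j\<^sup>2)" by (simp add: pw)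
    have 2: "qprod (- q) (q\<^sup>2) (Suc N) = qprod (- q) (q\<^sup>2) N * (1 + q ^ (2 * N + 1))"
      by (simp add: qprod_Suc flip: power_mult)
    show "d j * q powi (- 2 * j) * (1 - q powi (2 * j + 1)) * ((1 + q powi (2 * j + 1)) *
      (\<Sum>s\<le>N. ?w s * rfac (q\<^sup>2) (int s - j) * rfac (q\<^sup>2) (int s + j + 1)))
      = qprod (- q) (q\<^sup>2) N * (d j * (1 - q powi (2 * j + 1)) * q powi (j\<^sup>2)
      * (1 + q ^ (2 * N + 1)) * (rfac (q\<^sup>2) (int N - j) * rfac (q\<^sup>2) (int N + j + 1)))"
      unfolding bailey_kernel_sum_1[OF q] 1[symmetric] 2 by (simp only: mult_ac)
  qed simp
  also have "\<dots> = 2 * ?R"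
    unfolding sum_distrib_left[symmetric] B[symmetric] by (simp only: mult_ac)
  finally show ?thesis by simp
qed

section \<open>The initial Bailey pair and the iteration of the two steps\<close>

lemma sum_telescope_int:
  fixes G :: "int \<Rightarrow> complex"
  assumes "a \<le> b"
  shows "(\<Sum>j = a..b. G j - G (j + 1)) = G a - G (b + 1)"
  using assms
proof (induction b rule: int_ge_induct)
  case (step i)
  have "{a..i + 1} = insert (i + 1) {a..i}" using step by auto
  then show ?case using step by simp
qed simp

text \<open>Creative telescoping: 1 - q^(2n+2) times the summand for n + 1 is the summand for n plus
  a difference in j, so the sum satisfies the first-order recurrence of 1/(q^2;q^2)_n.\<close>

lemma bsum_unit:
  assumes q: "norm q < 1" "q \<noteq> 0"
  shows "bsum q n (\<lambda>j. (- 1) powi j * q powi (j\<^sup>2)) = inverse (qprod (q\<^sup>2) (q\<^sup>2) n)"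
proof (induction n)
  case 0
  then show ?case by (simp add: bsum_def)
next
  case (Suc n)
  define m where "m = int (Suc n)"
  \<comment> \<open>The certificate of the telescoping; it vanishes at j = -m and j = m + 1, where
    an \<open>rfac\<close> has argument -1.\<close>
  define G where "G j = (- 1) powi j * q powi (j\<^sup>2 - j) * rfac q (m - j) * rfac q (m + j - 1)" for j
  have pw: "q powi i * q powi j = q powi (i + j)" for i j
    using q(2) by (simp add: power_int_add)
  let ?J = "{- m..m}"
  have key: "(1 - (q\<^sup>2) ^ Suc n) * ((- 1) powi j * q powi (j\<^sup>2) * rfac q (m - j) * rfac q (m + j))
     = (- 1) powi j * q powi (j\<^sup>2) * rfac q (int n - j) * rfac q (int n + j) + q powi m * (G j - G (j + 1))" for j
  proof -
    have n: "int n - j = (m - j) - 1" "int n + j = (m + j) - 1" "m - (j + 1) = (m - j) - 1" "m + (j + 1) - 1 = m + j"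
      by (simp_all add: m_def)
    have 1: "(q\<^sup>2) ^ Suc n = q powi (2 * m)"
      unfolding m_def by (metis mult.commute of_nat_mult of_nat_numeral power_int_of_nat power_mult)
    have 2: "(- 1 :: complex) powi (j + 1) = - ((- 1) powi j)" by (simp add: power_int_add)
    have scal: "(1 - q powi (2 * m)) * q powi (j\<^sup>2) = q powi (j\<^sup>2) * (1 - q powi (m - j)) * (1 - q powi (m + j))
        + q powi m * (q powi (j\<^sup>2 - j) * (1 - q powi (m + j)) + q powi ((j + 1)\<^sup>2 - (j + 1)) * (1 - q powi (m - j)))"
      by (simp add: right_diff_distrib left_diff_distrib distrib_left distrib_right pw) (simp add: power2_eq_square algebra_simps)
    have gen: "t * (x * s * y * z) = x * s * (u * y) * (v * z) + w * (x * a * y * (v * z) - - x * b * (u * y) * z)"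
      if "t * s = s * u * v + w * (a * v + b * u)" for t x y z s u v w a b :: complex
    proof -
      have "t * (x * s * y * z) = (t * s) * (x * y * z)" by simp
      then show ?thesis unfolding that by (simp add: algebra_simps)
    qed
    show ?thesis
      unfolding G_def n 1 2 rfac_rec[OF q(1), symmetric]
      by (rule gen[OF scal])
  qed
  have "(1 - (q\<^sup>2) ^ Suc n) * bsum q (Suc n) (\<lambda>j. (- 1) powi j * q powi (j\<^sup>2))
    = (\<Sum>j\<in>?J. (- 1) powi j * q powi (j\<^sup>2) * rfac q (int n - j) * rfac q (int n + j) + q powi m * (G j - G (j + 1)))"
    unfolding bsum_def sum_distrib_left m_def[symmetric] by (simp only: key)
  also have "\<dots> = bsum q n (\<lambda>j. (- 1) powi j * q powi (j\<^sup>2)) + q powi m * (\<Sum>j\<in>?J. G j - G (j + 1))"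
    unfolding sum.distrib sum_distrib_left[symmetric] by (subst bsum_superset[of ?J]) (auto simp: m_def)
  also have "(\<Sum>j\<in>?J. G j - G (j + 1)) = 0"
    by (subst sum_telescope_int) (auto simp: G_def m_def)
  finally have "(1 - (q\<^sup>2) ^ Suc n) * bsum q (Suc n) (\<lambda>j. (- 1) powi j * q powi (j\<^sup>2)) = inverse (qprod (q\<^sup>2) (q\<^sup>2) n)"
    by (simp add: Suc)
  moreover have "1 - (q\<^sup>2) ^ Suc n \<noteq> 0"
    using q by (intro one_minus_power_nz) (auto simp: norm_power power_less_one_iff)
  moreover have "B = inverse (P * x)" if "x * B = inverse P" "x \<noteq> 0" for x B P :: complex
    using that by (metis inverse_mult_distrib mult.commute right_inverse mult.left_neutral mult.assoc)
  ultimately show ?case by (simp add: qprod_Suc)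
qed

text \<open>Level t has summed out the t innermost variables while its own outer variable is fixed
  at N. The power of q belonging to that variable is attached only by the next level.\<close>

primrec chain :: "complex \<Rightarrow> (nat \<Rightarrow> nat) \<Rightarrow> nat \<Rightarrow> nat \<Rightarrow> complex" where
  "chain q l 0 N = qprod (- q) (q\<^sup>2) N * inverse (qprod (q ^ 4) (q ^ 4) N)"
| "chain q l (Suc t) N =
     (\<Sum>s\<le>N. q ^ (s\<^sup>2 + 2 * l t * s) * rfac (q\<^sup>2) (int N - int s) * chain q l t s)"

text \<open>Every step adds j^2 to the exponent. A step with linear weight also adds 2j; these steps
  occur at t = 0, 2, ..., D, so the linear coefficient climbs by 2 until it stops at D + 2.\<close>

lemma chain_eq_bsum:
  assumes q: "norm q < 1" "q \<noteq> 0" and "even D"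
    and l: "\<And>t. l t = (if even t \<and> t \<le> D then 1 else 0)"
  shows "chain q l t N = qprod (- q) (q\<^sup>2) N *
    bsum (q\<^sup>2) N (\<lambda>j. (- 1) powi j *
      q powi (int (t + 2) * j\<^sup>2 + int (min (2 * ((t + 1) div 2)) (D + 2)) * j))"
proof (induction t arbitrary: N)
  case 0
  have q2: "norm (q\<^sup>2) < 1" "q\<^sup>2 \<noteq> 0" using q by (auto simp: norm_power power_less_one_iff)
  have "(q\<^sup>2) powi x = q powi (2 * x)" for x
    by (simp add: power_int_mult)
  then show ?case using bsum_unit[OF q2, of N] by (simp flip: power_mult)
next
  case (Suc t)
  have pw: "q powi i * q powi j = q powi (i + j)" for i j
    using q(2) by (simp add: power_int_add)
  define L where "L t = min (2 * ((t + 1) div 2)) (D + 2)" for t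
  show ?case
  proof (cases "even t \<and> t \<le> D")
    case True
    then have L: "L t = t" "L (Suc t) = t + 2" using \<open>even D\<close> by (auto simp: L_def)
    \<comment> \<open>At this t the exponent is (t+2)j^2 + tj = (t+2)(j^2+j) - 2j. Since j^2 + j is
      fixed by j -> -1-j while the sign changes, \<open>bailey_step_1\<close> applies.\<close>
    define d where "d j = (- 1) powi j * q powi (int (t + 2) * (j\<^sup>2 + j))" for j
    have d: "d (- 1 - j) = - d j" for j
    proof -
      have "(- 1 - j)\<^sup>2 + (- 1 - j) = j\<^sup>2 + j" by (simp add: power2_eq_square algebra_simps)
      then have e: "int (t + 2) * ((- 1 - j)\<^sup>2 + (- 1 - j)) = int (t + 2) * (j\<^sup>2 + j)"
        by (rule arg_cong)
      have s: "(- 1 :: complex) powi (- 1 - j) = - ((- 1) powi j)"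
      proof -
        have "(- 1 :: complex) powi (- j) = (- 1) powi j"
          by (simp add: power_int_minus flip: power_int_inverse)
        then show ?thesis using power_int_add[of "- 1 :: complex" "- 1" "- j"] by simp
      qed
      show ?thesis unfolding d_def e s by simp
    qed
    have 1: "(- 1) powi j * q powi (int (t + 2) * j\<^sup>2 + int (L t) * j) = d j * q powi (- 2 * j)" for j
      unfolding d_def L mult.assoc pw by (simp add: algebra_simps)
    have 2: "(- 1) powi j * q powi (int (Suc t + 2) * j\<^sup>2 + int (L (Suc t)) * j) = d j * q powi (j\<^sup>2)" for j
      unfolding d_def L mult.assoc pw by (simp add: algebra_simps)
    have "chain q l (Suc t) N = (\<Sum>s\<le>N. qprod (- q) (q\<^sup>2) s * q ^ (s\<^sup>2 + 2 * s) * rfac (q\<^sup>2) (int N - int s)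
            * bsum (q\<^sup>2) s (\<lambda>j. d j * q powi (- 2 * j)))"
      unfolding chain.simps Suc.IH L_def[symmetric] 1 using True by (simp add: l mult_ac)
    also have "\<dots> = qprod (- q) (q\<^sup>2) N * bsum (q\<^sup>2) N (\<lambda>j. d j * q powi (j\<^sup>2))"
      using q d by (rule bailey_step_1)
    finally show ?thesis unfolding L_def[symmetric] 2 .
  next
    case False
    \<comment> \<open>Either t is odd and \<open>(t + 1) div 2\<close> stays the same, or t is even
      with t >= D + 2 and the cap is already reached.\<close>
    then have L: "L (Suc t) = L t" using \<open>even D\<close> unfolding L_def min_def by presburger
    have l0: "l t = 0" using False by (simp add: l)
    have 2: "(- 1) powi j * q powi (int (Suc t + 2) * j\<^sup>2 + int (L (Suc t)) * j)
      = (- 1) powi j * q powi (int (t + 2) * j\<^sup>2 + int (L t) * j) * q powi (j\<^sup>2)" for j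
      unfolding L mult.assoc pw by (simp add: algebra_simps)
    have "chain q l (Suc t) N = (\<Sum>s\<le>N. qprod (- q) (q\<^sup>2) s * q ^ (s\<^sup>2) * rfac (q\<^sup>2) (int N - int s)
            * bsum (q\<^sup>2) s (\<lambda>j. (- 1) powi j * q powi (int (t + 2) * j\<^sup>2 + int (L t) * j)))"
      unfolding chain.simps Suc.IH L_def[symmetric] l0 by (simp add: mult_ac)
    also have "\<dots> = qprod (- q) (q\<^sup>2) N * bsum (q\<^sup>2) N
        (\<lambda>j. (- 1) powi j * q powi (int (t + 2) * j\<^sup>2 + int (L t) * j) * q powi (j\<^sup>2))"
      by (rule bailey_step_0[OF q(1)])
    finally show ?thesis unfolding L_def[symmetric] 2 .
  qed
qed

section \<open>The finite Jacobi triple product\<close>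

text \<open>Each factor is rewritten by 1 - x^(-1) = -x^(-1) (1 - x), which reverses the order of
  the product; the monomials collect in front.\<close>

lemma qprod_reflect:
  fixes m b :: int
  assumes "q \<noteq> 0"
  shows "qprod (q powi (m + b - 2 * m * int n)) (q powi (2 * m)) n
     = (- 1) ^ n * q powi (b * int n - m * (int n)\<^sup>2) * qprod (q powi (m - b)) (q powi (2 * m)) n"
proof (induction n)
  case (Suc n)
  have pw: "q powi i * q powi j = q powi (i + j)" for i j
    using assms by (simp add: power_int_add)
  have pp: "(q powi (2 * m)) ^ n = q powi (2 * m * int n)"
    by (simp add: power_int_mult)
  have 1: "q powi (m + b - 2 * m * int (Suc n)) * q powi (2 * m) = q powi (m + b - 2 * m * int n)"
    unfolding pw by (simp add: algebra_simps)
  have 2: "1 - q powi (m + b - 2 * m * int (Suc n))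
     = - (q powi (b - m - 2 * m * int n)) * (1 - q powi (m - b) * (q powi (2 * m)) ^ n)"
    unfolding pp by (simp add: right_diff_distrib pw) (simp add: algebra_simps)
  have 3: "q powi (b * int (Suc n) - m * (int (Suc n))\<^sup>2) = q powi (b * int n - m * (int n)\<^sup>2) * q powi (b - m - 2 * m * int n)"
    unfolding pw by (simp add: algebra_simps power2_eq_square)
  have "qprod (q powi (m + b - 2 * m * int (Suc n))) (q powi (2 * m)) (Suc n)
     = (1 - q powi (m + b - 2 * m * int (Suc n))) * qprod (q powi (m + b - 2 * m * int n)) (q powi (2 * m)) n"
    unfolding 1[symmetric] by (rule qprod_Suc_left)
  also have "\<dots> = (- 1) ^ Suc n * q powi (b * int (Suc n) - m * (int (Suc n))\<^sup>2)
      * qprod (q powi (m - b)) (q powi (2 * m)) (Suc n)"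
    unfolding 2 3 Suc qprod_Suc by simp
  finally show ?case .
qed simp

text \<open>The q-binomial theorem with 2n factors, its summation index shifted by n. The product of
  length 2n splits in the middle and the lower half is turned round by
  \<open>qprod_reflect\<close>.\<close>

lemma finite_jacobi_triple:
  fixes b :: int and m :: nat
  assumes q: "norm q < 1" "q \<noteq> 0" and "m > 0"
  defines "p \<equiv> q ^ (2 * m)"
  shows "bsum p n (\<lambda>j. (- 1) powi j * q powi (int m * j\<^sup>2 + b * j))
     = qprod (q powi (int m - b)) p n * qprod (q powi (int m + b)) p n * rfac p (int (2 * n))"
proof -
  have pw: "q powi i * q powi j = q powi (i + j)" for i j
    using q(2) by (simp add: power_int_add)
  have p: "norm p < 1" using q \<open>m > 0\<close> by (auto simp: p_def norm_power power_less_one_iff)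
  have p': "p = q powi (2 * int m)"
    unfolding p_def by (metis of_nat_mult of_nat_numeral power_int_of_nat)
  have pn: "p ^ i = q powi (2 * int m * int i)" for i
    unfolding p' by (simp add: power_int_mult)
  define e where "e = q powi (int m + b - 2 * int m * int n)"
  \<comment> \<open>The monomial that \<open>qprod_reflect\<close> produces; it occurs on both sides
    and is cancelled at the end.\<close>
  define w where "w = (- 1) ^ n * q powi (b * int n - int m * (int n)\<^sup>2)"
  have w: "w \<noteq> 0" using q by (simp add: w_def)
  have "w * bsum p n (\<lambda>j. (- 1) powi j * q powi (int m * j\<^sup>2 + b * j))
     = (\<Sum>j = - int n..int n. w * ((- 1) powi j * q powi (int m * j\<^sup>2 + b * j) * rfac p (int n - j) * rfac p (int n + j)))"
    by (simp add: bsum_def sum_distrib_left)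
  also have "\<dots> = (\<Sum>r\<le>2 * n. rfac p (int r) * rfac p (int (2 * n) - int r) * (- e) ^ r * p ^ (r choose 2))"
  proof (rule sum.reindex_bij_witness[of _ "\<lambda>r. int r - int n" "\<lambda>j. nat (j + int n)"])
    fix j assume j: "j \<in> {- int n..int n}"
    define r where "r = nat (j + int n)"
    have jr: "j = int r - int n" using j by (simp add: r_def)
    have c2: "2 * int (r choose 2) = int r * (int r - 1)"
      by (induction r) (simp_all add: numeral_2_eq_2 algebra_simps)
    have e2: "2 * int m * int (r choose 2) = int m * (int r * (int r - 1))"
      unfolding c2[symmetric] by simp
    have 1: "p ^ (r choose 2) = q powi (int m * (int r * (int r - 1)))"
      unfolding pn e2 ..
    have 2: "(- e) ^ r = (- 1) ^ r * q powi ((int m + b - 2 * int m * int n) * int r)"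
      unfolding e_def by (subst power_minus) (simp add: power_int_mult)
    have 3: "(- 1 :: complex) ^ r = (- 1) ^ n * (- 1) powi j"
      unfolding jr by (simp add: power_int_diff)
    have 4: "q powi (b * int n - int m * (int n)\<^sup>2) * q powi (int m * j\<^sup>2 + b * j) =
       q powi ((int m + b - 2 * int m * int n) * int r) * q powi (int m * (int r * (int r - 1)))"
      unfolding pw jr by (simp add: algebra_simps power2_eq_square)
    have 5: "int n - j = int (2 * n) - int r" "int n + j = int r" by (simp_all add: jr)
    have "w * ((- 1) powi j * q powi (int m * j\<^sup>2 + b * j) * rfac p (int n - j) * rfac p (int n + j))
       = rfac p (int r) * rfac p (int (2 * n) - int r) * ((- 1) ^ n * (- 1) powi j)
          * (q powi (b * int n - int m * (int n)\<^sup>2) * q powi (int m * j\<^sup>2 + b * j))"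
      unfolding w_def 5 by (simp only: mult_ac)
    also have "\<dots> = rfac p (int r) * rfac p (int (2 * n) - int r) * (- e) ^ r * p ^ (r choose 2)"
      unfolding 1 2 unfolding 3 4 by (simp only: mult_ac)
    finally show "rfac p (int (nat (j + int n))) * rfac p (int (2 * n) - int (nat (j + int n))) * (- e) ^ nat (j + int n) * p ^ (nat (j + int n) choose 2)
      = w * ((- 1) powi j * q powi (int m * j\<^sup>2 + b * j) * rfac p (int n - j) * rfac p (int n + j))"
      unfolding r_def by (rule sym)
  qed auto
  also have "\<dots> = qprod e p (2 * n) * rfac p (int (2 * n))"
    using q_vandermonde[OF p, of "2 * n" e 0] by simp
  also have "qprod e p (2 * n) = qprod e p n * qprod (q powi (int m + b)) p n"
  proof -
    have "e * p ^ n = q powi (int m + b)" unfolding e_def pn pw by simp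
    then show ?thesis using qprod_add[of e p n n] by (simp add: mult_2)
  qed
  also have "qprod e p n = w * qprod (q powi (int m - b)) p n"
    unfolding e_def w_def p' by (rule qprod_reflect[OF q(2)])
  finally show ?thesis using w by simp
qed

section \<open>The multiple sum as an iterated sum\<close>

text \<open>
  Like in \<open>chain\<close>, the weights \<open>l\<close> of the linear exponents are counted from the innermost
  summation, so that \<open>N\<^sub>j\<close> has weight \<open>l (k - 1 - j)\<close>.
\<close>

definition multisum_term :: "nat \<Rightarrow> (nat \<Rightarrow> nat) \<Rightarrow> complex \<Rightarrow> nat \<Rightarrow> (nat \<Rightarrow> nat) \<Rightarrow> complex" where
  "multisum_term k l q i n = q ^ (\<Sum>j = i..k-1. (Nsum k n j)\<^sup>2 + 2 * l (k - 1 - j) * Nsum k n j)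
     * (\<Prod>j = i..k-2. rfac (q\<^sup>2) (int (n j))) * chain q l 0 (n (k - 1))"

definition fibre :: "nat \<Rightarrow> nat \<Rightarrow> nat \<Rightarrow> (nat \<Rightarrow> nat) set" where
  "fibre k i s = {n \<in> {i..k-1} \<rightarrow>\<^sub>E UNIV. Nsum k n i = s}"

lemma finite_fibre: "finite (fibre k i s)"
proof (rule finite_subset)
  show "fibre k i s \<subseteq> {i..k-1} \<rightarrow>\<^sub>E {..s}"
  proof
    fix n assume n: "n \<in> fibre k i s"
    have "n j \<le> s" if "j \<in> {i..k-1}" for j
      using n member_le_sum[of j "{i..k-1}" n] that by (simp add: fibre_def Nsum_def)
    then show "n \<in> {i..k-1} \<rightarrow>\<^sub>E {..s}" using n by (auto simp: fibre_def PiE_iff)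
  qed
qed (simp add: finite_PiE)

lemma Nsum_rec: "i \<le> k - 1 \<Longrightarrow> Nsum k n i = n i + Nsum k n (Suc i)"
  by (simp add: Nsum_def sum.atLeast_Suc_atMost)

lemma Nsum_upd: "i < j \<Longrightarrow> Nsum k (n(i := x)) j = Nsum k n j"
  unfolding Nsum_def by (rule sum.cong) auto

text \<open>With N_i = s fixed, choosing n_i is the same as choosing t = N_(i+1) <= s, because n_i =
  s - t.\<close>

lemma sum_fibre_Suc:
  assumes "i < k - 1"
  shows "(\<Sum>n\<in>fibre k i s. f n) = (\<Sum>t\<le>s. \<Sum>n\<in>fibre k (Suc i) t. f (n(i := s - t)))"
proof -
  have "(\<Sum>t\<le>s. \<Sum>n\<in>fibre k (Suc i) t. f (n(i := s - t)))
      = (\<Sum>(t, n)\<in>Sigma {..s} (fibre k (Suc i)). f (n(i := s - t)))"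
    by (rule sum.Sigma) (auto simp: finite_fibre)
  also have "\<dots> = (\<Sum>n\<in>fibre k i s. f n)"
  proof (rule sum.reindex_bij_witness[of _ "\<lambda>n. (Nsum k n (Suc i), n(i := undefined))" "\<lambda>(t, n). n(i := s - t)"])
    fix x assume "x \<in> Sigma {..s} (fibre k (Suc i))"
    then obtain t n where x: "x = (t, n)" "t \<le> s" "n \<in> {Suc i..k-1} \<rightarrow>\<^sub>E UNIV" "Nsum k n (Suc i) = t"
      by (auto simp: fibre_def)
    \<comment> \<open>Tuples are extensional, so resetting position i to \<open>undefined\<close>
      recovers the shorter tuple exactly.\<close>
    have ni: "n i = undefined" using x(3) by (auto simp: PiE_def extensional_def)
    have "{i..k-1} = insert i {Suc i..k-1}" using assms by auto
    then have "n(i := s - t) \<in> {i..k-1} \<rightarrow>\<^sub>E UNIV" using x(3) by (auto simp: PiE_def extensional_def)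
    then show "(case x of (t, n) \<Rightarrow> n(i := s - t)) \<in> fibre k i s"
      using x assms by (simp add: fibre_def Nsum_rec Nsum_upd)
    show "(Nsum k (case x of (t, n) \<Rightarrow> n(i := s - t)) (Suc i), (case x of (t, n) \<Rightarrow> n(i := s - t))(i := undefined)) = x"
      using x ni by (auto simp: Nsum_upd)
  next
    fix n assume n: "n \<in> fibre k i s"
    then have s: "s = n i + Nsum k n (Suc i)" using assms by (simp add: fibre_def Nsum_rec)
    then show "(case (Nsum k n (Suc i), n(i := undefined)) of (t, n) \<Rightarrow> n(i := s - t)) = n" by auto
    have "n(i := undefined) \<in> {Suc i..k-1} \<rightarrow>\<^sub>E UNIV" using n by (auto simp: fibre_def PiE_def extensional_def)
    then show "(Nsum k n (Suc i), n(i := undefined)) \<in> Sigma {..s} (fibre k (Suc i))"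
      using s by (auto simp: fibre_def Nsum_upd)
  qed auto
  finally show ?thesis by simp
qed

text \<open>Induction from the innermost variable outwards: \<open>sum_fibre_Suc\<close> peels off
  one variable, and its factor \<open>rfac (s - u)\<close> is the kernel in the recursion of
  \<open>chain\<close>.\<close>

lemma sum_fibre_multisum_term:
  assumes "Suc t < k"
  shows "(\<Sum>n\<in>fibre k (k - Suc t) s. multisum_term k l q (k - Suc t) n) = q ^ (s\<^sup>2 + 2 * l t * s) * chain q l t s"
  using assms
proof (induction t arbitrary: s)
  case 0
  have "fibre k (k - 1) s = {\<lambda>j\<in>{k-1}. s}"
    by (auto simp: fibre_def Nsum_def PiE_def extensional_def fun_eq_iff)
  \<comment> \<open>This uses k >= 2: for k = 1 truncated subtraction would leave the index 0 in the
    range.\<close>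
  moreover have "{k - 1..k - 2} = {}" using 0 by auto
  ultimately show ?case by (simp add: multisum_term_def Nsum_def)
next
  case (Suc t)
  define i where "i = k - Suc (Suc t)"
  have i: "i < k - 1" "Suc i = k - Suc t" "k - 1 - i = Suc t" using Suc.prems by (auto simp: i_def)
  have "(\<Sum>n\<in>fibre k i s. multisum_term k l q i n)
     = (\<Sum>u\<le>s. \<Sum>n\<in>fibre k (Suc i) u. multisum_term k l q i (n(i := s - u)))"
    by (rule sum_fibre_Suc[OF i(1)])
  also have "\<dots> = (\<Sum>u\<le>s. \<Sum>n\<in>fibre k (Suc i) u. q ^ (s\<^sup>2 + 2 * l (Suc t) * s) * rfac (q\<^sup>2) (int s - int u) * multisum_term k l q (Suc i) n)"
  proof (intro sum.cong refl)
    fix u n assume u: "u \<in> {..s}" and n: "n \<in> fibre k (Suc i) u"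
    let ?n = "n(i := s - u)"
    have N: "Nsum k ?n i = s" using n u i by (simp add: Nsum_rec Nsum_upd fibre_def)
    have 1: "(\<Sum>j = i..k-1. (Nsum k ?n j)\<^sup>2 + 2 * l (k - 1 - j) * Nsum k ?n j)
       = (s\<^sup>2 + 2 * l (Suc t) * s) + (\<Sum>j = Suc i..k-1. (Nsum k n j)\<^sup>2 + 2 * l (k - 1 - j) * Nsum k n j)"
      using i by (simp add: sum.atLeast_Suc_atMost[of i] N Nsum_upd)
    have 2: "(\<Prod>j = i..k-2. rfac (q\<^sup>2) (int (?n j))) = rfac (q\<^sup>2) (int s - int u) * (\<Prod>j = Suc i..k-2. rfac (q\<^sup>2) (int (n j)))"
      using i u by (simp add: prod.atLeast_Suc_atMost[of i] of_nat_diff)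
    have 3: "?n (k - 1) = n (k - 1)" using i by simp
    show "multisum_term k l q i ?n = q ^ (s\<^sup>2 + 2 * l (Suc t) * s) * rfac (q\<^sup>2) (int s - int u) * multisum_term k l q (Suc i) n"
      unfolding multisum_term_def 1 2 3 power_add by (simp only: mult_ac)
  qed
  also have "\<dots> = (\<Sum>u\<le>s. q ^ (s\<^sup>2 + 2 * l (Suc t) * s) * rfac (q\<^sup>2) (int s - int u) * (q ^ (u\<^sup>2 + 2 * l t * u) * chain q l t u))"
    unfolding sum_distrib_left[symmetric] i(2) using Suc.IH Suc.prems by simp
  also have "\<dots> = q ^ (s\<^sup>2 + 2 * l (Suc t) * s) * chain q l (Suc t) s"
    by (simp add: sum_distrib_left mult_ac)
  finally show ?case unfolding i_def .
qed

section \<open>Passage to the limit\<close>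

text \<open>Dominated convergence for the counting measure with majorant |f| K; for complex
  families, unconditional and absolute summability agree.\<close>

lemma tendsto_infsum_dominated:
  fixes f h :: "'a \<Rightarrow> complex" and g :: "nat \<Rightarrow> 'a \<Rightarrow> complex"
  assumes f: "f summable_on A" and bound: "\<And>n x. x \<in> A \<Longrightarrow> norm (g n x) \<le> K"
    and lim: "\<And>x. x \<in> A \<Longrightarrow> (\<lambda>n. g n x) \<longlonglongrightarrow> h x"
  shows "(\<lambda>n. \<Sum>\<^sub>\<infinity>x\<in>A. f x * g n x) \<longlonglongrightarrow> (\<Sum>\<^sub>\<infinity>x\<in>A. f x * h x)"
proof -
  have f': "Infinite_Set_Sum.abs_summable_on f A"
    using f by (simp add: summable_on_iff_abs_summable_on_complex abs_summable_equivalent[symmetric])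
  have w: "integrable (count_space A) (\<lambda>x. norm (f x) * K)"
    using f' by (simp add: Infinite_Set_Sum.abs_summable_on_def integrable_norm)
  have b: "AE x in count_space A. norm (f x * g n x) \<le> norm (f x) * K" for n
    by (auto simp: AE_count_space norm_mult intro!: mult_left_mono bound)
  have l: "AE x in count_space A. (\<lambda>n. f x * g n x) \<longlonglongrightarrow> f x * h x"
    by (auto simp: AE_count_space intro!: tendsto_intros lim)
  have i: "Infinite_Set_Sum.abs_summable_on (\<lambda>x. f x * g n x) A" for n
    unfolding Infinite_Set_Sum.abs_summable_on_def
    by (rule integrable_dominated_convergence2[OF _ _ w l b]) auto
  have i': "Infinite_Set_Sum.abs_summable_on (\<lambda>x. f x * h x) A"
    unfolding Infinite_Set_Sum.abs_summable_on_def
    by (rule integrable_dominated_convergence[OF _ _ w l b]) auto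
  have "(\<lambda>n. integral\<^sup>L (count_space A) (\<lambda>x. f x * g n x)) \<longlonglongrightarrow> integral\<^sup>L (count_space A) (\<lambda>x. f x * h x)"
    by (rule integral_dominated_convergence[OF _ _ w l b]) auto
  then show ?thesis
    using infsetsum_infsum[OF i] infsetsum_infsum[OF i'] by (simp add: infsetsum_def)
qed

lemma qprod_tendsto:
  assumes "norm q < 1"
  shows "qprod a q \<longlonglongrightarrow> qpoch_inf a q"
  using convergent_prod_LIMSEQ[OF convergent_prod_qpoch[OF assms, of a]]
  by (simp add: qprod_def[abs_def] qpoch_inf_def LIMSEQ_lessThan_iff_atMost)

lemma qpoch_eq_qprod:
  assumes "norm q < 1" "norm a < 1"
  shows "qpoch a q n = qprod a q n"
  unfolding qprod_def
proof (rule qpoch_eq_prod[OF assms(1)])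
  fix j
  have "norm (a * q ^ j) \<le> norm a * 1"
    unfolding norm_mult norm_power using assms by (intro mult_left_mono power_le_one) auto
  then show "a * q ^ j \<noteq> 1" using assms(2) by auto
qed

lemma qpoch_inf_nz:
  assumes "norm q < 1"
  shows "qpoch_inf q q \<noteq> 0"
  unfolding qpoch_inf_def
proof (rule prodinf_nonzero[OF convergent_prod_qpoch[OF assms]])
  show "1 - q * q ^ j \<noteq> 0" for j
    using one_minus_power_nz[OF assms, of "Suc j"] by simp
qed

lemma rfac_tendsto:
  assumes q: "norm q < 1"
  shows "(\<lambda>n. rfac q (int n + j)) \<longlonglongrightarrow> inverse (qpoch_inf q q)"
proof -
  have "(\<lambda>n. inverse (qprod q q n)) \<longlonglongrightarrow> inverse (qpoch_inf q q)"
    by (intro tendsto_inverse qprod_tendsto q qpoch_inf_nz)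
  moreover have "filterlim (\<lambda>n. nat (int n + j)) sequentially sequentially"
    unfolding filterlim_at_top
  proof
    fix Z
    show "eventually (\<lambda>n. Z \<le> nat (int n + j)) sequentially"
      using eventually_ge_at_top[of "Z + nat \<bar>j\<bar>"] by eventually_elim auto
  qed
  ultimately have "(\<lambda>n. inverse (qprod q q (nat (int n + j)))) \<longlonglongrightarrow> inverse (qpoch_inf q q)"
    by (rule filterlim_compose)
  moreover have "eventually (\<lambda>n. inverse (qprod q q (nat (int n + j))) = rfac q (int n + j)) sequentially"
    using eventually_ge_at_top[of "nat \<bar>j\<bar>"] by eventually_elim (auto simp: rfac_def)
  ultimately show ?thesis by (rule Lim_transform_eventually)
qed

lemma qprod_bounded:
  assumes "norm q < 1"
  obtains K where "K > 0" "\<And>n. norm (qprod a q n) \<le> K"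
  using convergent_imp_Bseq[OF convergentI[OF qprod_tendsto[OF assms, of a]]]
  by (auto simp: Bseq_def)

lemma rfac_bounded:
  assumes "norm q < 1"
  obtains K where "K > 0" "\<And>n. norm (rfac q n) \<le> K"
proof -
  have "Bseq (\<lambda>n. rfac q (int n + 0))"
    by (intro convergent_imp_Bseq convergentI[OF rfac_tendsto[OF assms]])
  then obtain K where K: "K > 0" "\<And>n. norm (rfac q (int n)) \<le> K"
    by (auto simp: Bseq_def)
  have "norm (rfac q n) \<le> K" for n
    using K(1) K(2)[of "nat n"] by (cases "n < 0") auto
  then show ?thesis using K(1) that by blast
qed

text \<open>The vanishing of \<open>rfac\<close> extends the sum to all integers. Its two factors
  are bounded uniformly and each tends to 1/(q;q)_inf for fixed j, so the limit may be taken
  termwise.\<close>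

lemma bsum_tendsto:
  assumes q: "norm q < 1" and c: "c summable_on UNIV"
  shows "(\<lambda>N. bsum q N c) \<longlonglongrightarrow> (\<Sum>\<^sub>\<infinity>j. c j) * (inverse (qpoch_inf q q))\<^sup>2"
proof -
  obtain K where K: "K > 0" "\<And>n. norm (rfac q n) \<le> K" using rfac_bounded[OF q] by blast
  have "(\<lambda>N. \<Sum>\<^sub>\<infinity>j. c j * (rfac q (int N - j) * rfac q (int N + j)))
     \<longlonglongrightarrow> (\<Sum>\<^sub>\<infinity>j. c j * (inverse (qpoch_inf q q) * inverse (qpoch_inf q q)))"
  proof (rule tendsto_infsum_dominated[OF c])
    show "norm (rfac q (int N - j) * rfac q (int N + j)) \<le> K * K" for N j
      unfolding norm_mult by (intro mult_mono K) (use K in auto)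
    show "(\<lambda>N. rfac q (int N - j) * rfac q (int N + j)) \<longlonglongrightarrow> inverse (qpoch_inf q q) * inverse (qpoch_inf q q)" for j
      using tendsto_mult[OF rfac_tendsto[OF q, of "- j"] rfac_tendsto[OF q, of j]] by simp
  qed
  moreover have "(\<Sum>\<^sub>\<infinity>j. c j * (rfac q (int N - j) * rfac q (int N + j))) = bsum q N c" for N
  proof -
    have "(\<Sum>\<^sub>\<infinity>j. c j * (rfac q (int N - j) * rfac q (int N + j)))
       = (\<Sum>\<^sub>\<infinity>j\<in>{- int N..int N}. c j * (rfac q (int N - j) * rfac q (int N + j)))"
      by (rule infsum_cong_neutral) (auto simp: not_le)
    then show ?thesis by (simp add: bsum_def mult_ac)
  qed
  ultimately show ?thesis
    by (simp add: infsum_cmult_left' power2_eq_square)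
qed

section \<open>Theta series and the Jacobi triple product\<close>

lemma summable_on_geometric_int:
  assumes "0 \<le> r" "r < (1 :: real)"
  shows "(\<lambda>j :: int. r ^ nat \<bar>j\<bar>) summable_on UNIV"
proof -
  have s: "(\<lambda>n. r ^ n) summable_on UNIV"
    using assms by (intro norm_summable_imp_summable_on) (simp add: norm_power summable_geometric)
  have "(\<lambda>j :: int. r ^ nat \<bar>j\<bar>) summable_on range int"
    using s by (subst summable_on_reindex) (auto simp: o_def)
  moreover have "(\<lambda>j :: int. r ^ nat \<bar>j\<bar>) summable_on range (\<lambda>n. - int n)"
    using s by (subst summable_on_reindex) (auto simp: o_def inj_def)
  ultimately have "(\<lambda>j :: int. r ^ nat \<bar>j\<bar>) summable_on (range int \<union> range (\<lambda>n. - int n))"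
    by (rule summable_on_union)
  moreover have "range int \<union> range (\<lambda>n. - int n) = UNIV"
    by (auto intro: int_cases2)
  ultimately show ?thesis by simp
qed

text \<open>From |b| <= m - 1 and |j| <= j^2 the exponent is at least |j|, so a two-sided geometric
  series is a majorant.\<close>

lemma theta_summable:
  fixes q :: complex and b m :: int
  assumes q: "norm q < 1" "q \<noteq> 0" and b: "\<bar>b\<bar> < m"
  shows "(\<lambda>j. (- 1) powi j * q powi (m * j\<^sup>2 + b * j)) summable_on UNIV"
proof (rule Infinite_Sum.abs_summable_summable, rule Infinite_Sum.abs_summable_on_comparison_test)
  show "(\<lambda>j :: int. norm (norm q ^ nat \<bar>j\<bar>)) summable_on UNIV"
    using summable_on_geometric_int[of "norm q"] q by (simp add: norm_power)
  fix j :: int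
  have "\<bar>j\<bar> \<le> m * j\<^sup>2 + b * j"
  proof -
    have "\<bar>b * j\<bar> \<le> (m - 1) * \<bar>j\<bar>"
      unfolding abs_mult using b by (intro mult_right_mono) auto
    moreover have "\<bar>j\<bar> \<le> j\<^sup>2"
      by (metis abs_ge_zero abs_le_square_iff abs_power2 abs_zero int_one_le_iff_zero_less linorder_not_le mult_le_cancel_left1 order_le_less power2_abs power2_eq_square zero_eq_power2 zero_less_abs_iff)
    then have "m * \<bar>j\<bar> \<le> m * j\<^sup>2"
      using b by (intro mult_left_mono) auto
    ultimately show ?thesis by (simp add: algebra_simps)
  qed
  then have "norm (q powi (m * j\<^sup>2 + b * j)) = norm q ^ nat (m * j\<^sup>2 + b * j)" "nat \<bar>j\<bar> \<le> nat (m * j\<^sup>2 + b * j)"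
    by (auto simp: power_int_def norm_power)
  then show "norm ((- 1) powi j * q powi (m * j\<^sup>2 + b * j)) \<le> norm (norm q ^ nat \<bar>j\<bar>)"
    using q by (simp add: norm_mult norm_power_int power_decreasing)
qed

text \<open>The two sides of \<open>finite_jacobi_triple\<close> have limits as n grows; equating
  them and clearing 1/(p;p)_inf^2 gives the product.\<close>

lemma jacobi_triple_product:
  fixes q :: complex and m :: nat and b :: int
  assumes q: "norm q < 1" "q \<noteq> 0" and b: "\<bar>b\<bar> < int m"
  defines "p \<equiv> q ^ (2 * m)"
  shows "(\<Sum>\<^sub>\<infinity>j. (- 1) powi j * q powi (int m * j\<^sup>2 + b * j))
     = qpoch_inf (q powi (int m - b)) p * qpoch_inf (q powi (int m + b)) p * qpoch_inf p p"
proof -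
  have m: "m > 0" using b by simp
  have p: "norm p < 1" using q m by (auto simp: p_def norm_power power_less_one_iff)
  let ?c = "\<lambda>j. (- 1) powi j * q powi (int m * j\<^sup>2 + b * j)"
  have "(\<lambda>n. bsum p n ?c) \<longlonglongrightarrow> (\<Sum>\<^sub>\<infinity>j. ?c j) * (inverse (qpoch_inf p p))\<^sup>2"
    by (rule bsum_tendsto[OF p theta_summable[OF q b]])
  moreover have "(\<lambda>n. bsum p n ?c) \<longlonglongrightarrow>
      qpoch_inf (q powi (int m - b)) p * qpoch_inf (q powi (int m + b)) p * inverse (qpoch_inf p p)"
  proof -
    have "(\<lambda>n. rfac p (int n + 0)) \<longlonglongrightarrow> inverse (qpoch_inf p p)"
      by (rule rfac_tendsto[OF p])
    then have "(\<lambda>n. rfac p (int (2 * n))) \<longlonglongrightarrow> inverse (qpoch_inf p p)"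
      using LIMSEQ_subseq_LIMSEQ[of "\<lambda>n. rfac p (int n)" _ "\<lambda>n. 2 * n"]
      by (simp add: o_def strict_mono_def)
    then show ?thesis
      unfolding p_def finite_jacobi_triple[OF q m]
      by (intro tendsto_mult qprod_tendsto) (use p in \<open>auto simp: p_def\<close>)
  qed
  ultimately have "(\<Sum>\<^sub>\<infinity>j. ?c j) * (inverse (qpoch_inf p p))\<^sup>2
      = qpoch_inf (q powi (int m - b)) p * qpoch_inf (q powi (int m + b)) p * inverse (qpoch_inf p p)"
    by (rule LIMSEQ_unique)
  then show ?thesis
    using qpoch_inf_nz[OF p] by (simp add: field_simps power2_eq_square)
qed

text \<open>The exponent is at least the sum of the n_j because N_j^2 >= N_j >= n_j, while all
  q-products and their reciprocals are bounded. A product of geometric series is therefore a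
  majorant.\<close>

lemma multisum_term_summable:
  assumes q: "norm q < 1"
  shows "multisum_term k l q 1 summable_on ({1..k-1} \<rightarrow>\<^sub>E UNIV)"
proof -
  have q2: "norm (q\<^sup>2) < 1" "norm (q ^ 4) < 1" using q by (auto simp: norm_power power_less_one_iff)
  obtain K1 where K1: "K1 > 0" "\<And>n. norm (qprod (- q) (q\<^sup>2) n) \<le> K1"
    using qprod_bounded[OF q2(1)] by blast
  obtain K2 where K2: "K2 > 0" "\<And>n. norm (rfac (q\<^sup>2) n) \<le> K2"
    using rfac_bounded[OF q2(1)] by blast
  obtain K3 where K3: "K3 > 0" "\<And>n. norm (rfac (q ^ 4) n) \<le> K3"
    using rfac_bounded[OF q2(2)] by blast
  define K where "K = K2 ^ card {1..k-2} * (K1 * K3)"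
  let ?A = "{1..k-1} \<rightarrow>\<^sub>E (UNIV :: nat set)"
  let ?w = "\<lambda>n. \<Prod>j\<in>{1..k-1}. norm q ^ n j"
  have "Infinite_Set_Sum.abs_summable_on ?w ?A"
  proof (rule abs_summable_on_prod_PiE)
    show "Infinite_Set_Sum.abs_summable_on (\<lambda>n. norm q ^ n) (UNIV :: nat set)"
      using q by (simp add: abs_summable_on_nat_iff' summable_geometric)
  qed auto
  then have "?w summable_on ?A"
    by (rule summable_on_iff_abs_summable_on_real[THEN iffD2, OF abs_summable_equivalent[THEN iffD2]])
  then have "(\<lambda>n. K * ?w n) summable_on ?A"
    by (rule summable_on_cmult_right)
  then have "(\<lambda>n. norm (K * ?w n)) summable_on ?A"
    by (rule summable_on_iff_abs_summable_on_real[THEN iffD1])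
  moreover have "norm (multisum_term k l q 1 n) \<le> norm (K * ?w n)" for n
  proof -
    have "(\<Sum>j = 1..k-1. n j) \<le> (\<Sum>j = 1..k-1. (Nsum k n j)\<^sup>2 + 2 * l (k - 1 - j) * Nsum k n j)"
    proof (rule sum_mono)
      fix j assume j: "j \<in> {1..k-1}"
      have "n j \<le> Nsum k n j" using j by (simp add: Nsum_rec)
      also have "\<dots> \<le> (Nsum k n j)\<^sup>2" by (simp add: power2_eq_square)
      finally show "n j \<le> (Nsum k n j)\<^sup>2 + 2 * l (k - 1 - j) * Nsum k n j" by simp
    qed
    then have 1: "norm (q ^ (\<Sum>j = 1..k-1. (Nsum k n j)\<^sup>2 + 2 * l (k - 1 - j) * Nsum k n j)) \<le> ?w n"
      unfolding norm_power power_sum[symmetric] using q by (intro power_decreasing) auto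
    have 2: "norm (\<Prod>j = 1..k-2. rfac (q\<^sup>2) (int (n j))) \<le> K2 ^ card {1..k-2}"
      unfolding prod_norm[symmetric] prod_constant[symmetric] by (intro prod_mono conjI norm_ge_zero K2)
    have 3: "norm (chain q l 0 (n (k - 1))) \<le> K1 * K3"
      using K1 K3 by (simp add: norm_mult rfac_of_nat[symmetric] mult_mono less_imp_le)
    have "norm (multisum_term k l q 1 n) \<le> (?w n * K2 ^ card {1..k-2}) * (K1 * K3)"
      unfolding multisum_term_def norm_mult[of _ "chain q l 0 _"] norm_mult[of "q ^ _"]
      by (intro mult_mono 1 2 3 mult_nonneg_nonneg prod_nonneg) (use K1 K2 K3 in auto)
    also have "\<dots> = K * ?w n" by (simp add: K_def)
    also have "\<dots> \<le> norm (K * ?w n)" by simp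
    finally show ?thesis .
  qed
  ultimately have "(\<lambda>n. norm (multisum_term k l q 1 n)) summable_on ?A"
    by (rule Infinite_Sum.abs_summable_on_comparison_test)
  then show ?thesis by (rule Infinite_Sum.abs_summable_summable)
qed

lemma has_sum_fibres:
  fixes f :: "(nat \<Rightarrow> nat) \<Rightarrow> complex"
  assumes "(f has_sum S) ({i..k-1} \<rightarrow>\<^sub>E UNIV)"
  shows "((\<lambda>s. \<Sum>n\<in>fibre k i s. f n) has_sum S) UNIV"
proof (rule has_sum_SigmaD)
  define X where "X = {i..k-1} \<rightarrow>\<^sub>E (UNIV :: nat set)"
  have fibre: "n \<in> fibre k i s \<longleftrightarrow> n \<in> X \<and> Nsum k n i = s" for n s
    unfolding fibre_def X_def by (rule mem_Collect_eq)
  have "((\<lambda>(s, n). f n) has_sum S) (Sigma UNIV (fibre k i)) = (f has_sum S) X"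
    by (rule has_sum_reindex_bij_witness[of _ "\<lambda>n. (Nsum k n i, n)" snd]) (auto simp: fibre)
  with assms show "((\<lambda>(s, n). f n) has_sum S) (Sigma UNIV (fibre k i))" unfolding X_def by (rule iffD2[rotated])
  show "((\<lambda>n. case (s, n) of (s, n) \<Rightarrow> f n) has_sum (\<Sum>n\<in>fibre k i s. f n)) (fibre k i s)" for s
    unfolding prod.case by (rule has_sum_finite[OF finite_fibre])
qed

text \<open>One chain step beyond the multiple sum S is taken. As N grows,
  \<open>chain q l (k - 1) N\<close> tends to S P with P = 1/(q^2;q^2)_inf, and by
  \<open>chain_eq_bsum\<close> also to (-q;q^2)_inf times the theta series times P^2; one factor P
  cancels.\<close>

lemma multisum_eq_theta:
  assumes q: "norm q < 1" "q \<noteq> 0" and k: "k \<ge> 2" and "even D" and D: "D + 2 \<le> k"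
    and l: "\<And>t. l t = (if even t \<and> t \<le> D then 1 else 0)"
  shows "(multisum_term k l q 1 has_sum
      (qpoch_inf (- q) (q\<^sup>2) * (\<Sum>\<^sub>\<infinity>j. (- 1) powi j * q powi (int (k + 1) * j\<^sup>2 + int (D + 2) * j))
        / qpoch_inf (q\<^sup>2) (q\<^sup>2))) ({1..k-1} \<rightarrow>\<^sub>E UNIV)"
proof -
  have q2: "norm (q\<^sup>2) < 1" using q by (auto simp: norm_power power_less_one_iff)
  define S where "S = (\<Sum>\<^sub>\<infinity>n\<in>{1..k-1} \<rightarrow>\<^sub>E UNIV. multisum_term k l q 1 n)"
  define P where "P = inverse (qpoch_inf (q\<^sup>2) (q\<^sup>2))"
  define g where "g s = q ^ (s\<^sup>2 + 2 * l (k - 2) * s) * chain q l (k - 2) s" for s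
  let ?c = "\<lambda>j. (- 1) powi j * q powi (int (k + 1) * j\<^sup>2 + int (D + 2) * j)"
  have S: "(multisum_term k l q 1 has_sum S) ({1..k-1} \<rightarrow>\<^sub>E UNIV)"
    unfolding S_def by (intro has_sum_infsum multisum_term_summable q)
  have k': "k - Suc (k - 2) = 1" "Suc (k - 2) < k" "k - 1 = Suc (k - 2)" using k by auto
  have g: "(g has_sum S) UNIV"
    using has_sum_fibres[OF S] sum_fibre_multisum_term[OF k'(2), of l q] unfolding k'(1) g_def by simp
  obtain K where K: "\<And>n. norm (rfac (q\<^sup>2) n) \<le> K" using rfac_bounded[OF q2] by blast
  have "(\<lambda>N. \<Sum>\<^sub>\<infinity>s. g s * rfac (q\<^sup>2) (int N - int s)) \<longlonglongrightarrow> (\<Sum>\<^sub>\<infinity>s. g s * P)"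
  proof (rule tendsto_infsum_dominated)
    show "g summable_on UNIV" using g by (rule has_sum_imp_summable)
    show "(\<lambda>N. rfac (q\<^sup>2) (int N - int s)) \<longlonglongrightarrow> P" for s
      using rfac_tendsto[OF q2, of "- int s"] by (simp add: P_def)
  qed (rule K)
  moreover have "(\<Sum>\<^sub>\<infinity>s. g s * rfac (q\<^sup>2) (int N - int s)) = chain q l (k - 1) N" for N
  proof -
    have "(\<Sum>\<^sub>\<infinity>s. g s * rfac (q\<^sup>2) (int N - int s)) = (\<Sum>\<^sub>\<infinity>s\<in>{..N}. g s * rfac (q\<^sup>2) (int N - int s))"
      by (rule infsum_cong_neutral) auto
    then show ?thesis unfolding k'(3) by (simp add: g_def mult_ac)
  qed
  moreover have "(\<Sum>\<^sub>\<infinity>s. g s * P) = S * P"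
    using g by (simp add: infsum_cmult_left' infsumI)
  ultimately have "chain q l (k - 1) \<longlonglongrightarrow> S * P"
    by simp
  moreover have "chain q l (k - 1) \<longlonglongrightarrow> qpoch_inf (- q) (q\<^sup>2) * ((\<Sum>\<^sub>\<infinity>j. ?c j) * P\<^sup>2)"
  proof -
    have 1: "k - 1 + 2 = k + 1" using k by simp
    \<comment> \<open>The cap has been reached: D is even and D + 2 <= k, so 2 (k div 2) >= D +
      2.\<close>
    have 2: "min (2 * ((k - 1 + 1) div 2)) (D + 2) = D + 2" using k D \<open>even D\<close> unfolding min_def by presburger
    have "chain q l (k - 1) = (\<lambda>N. qprod (- q) (q\<^sup>2) N * bsum (q\<^sup>2) N ?c)"
      using chain_eq_bsum[OF q \<open>even D\<close> l, of "k - 1"] unfolding 1 2 by (rule ext)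
    moreover have "?c summable_on UNIV"
      using D k by (intro theta_summable q) auto
    ultimately show ?thesis
      unfolding P_def by (simp only:) (intro tendsto_mult qprod_tendsto bsum_tendsto q2)
  qed
  ultimately have "S * P = qpoch_inf (- q) (q\<^sup>2) * ((\<Sum>\<^sub>\<infinity>j. ?c j) * P\<^sup>2)"
    by (rule LIMSEQ_unique)
  moreover have "P \<noteq> 0" using qpoch_inf_nz[OF q2] by (simp add: P_def)
  ultimately have "S = qpoch_inf (- q) (q\<^sup>2) * (\<Sum>\<^sub>\<infinity>j. ?c j) * P"
    by (simp add: power2_eq_square)
  with S show ?thesis by (simp add: P_def divide_inverse)
qed

section \<open>The case q = 0 and the final identity\<close>

lemma qpoch_inf_0_left [simp]: "qpoch_inf 0 q = 1"
  by (simp add: qpoch_inf_def)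

text \<open>Negative powers of q in the chain argument force q = 0 to be treated apart. There only
  the zero tuple survives, since any nonzero n_j makes the exponent positive.\<close>

lemma multisum_term_has_sum_0:
  "(multisum_term k l 0 1 has_sum 1) ({1..k-1} \<rightarrow>\<^sub>E UNIV)"
proof -
  define z where "z = (\<lambda>j\<in>{1..k-1}. 0 :: nat)"
  have r: "rfac 0 (int n) = 1" for n by (simp add: rfac_of_nat)
  have z: "multisum_term k l 0 1 z = 1"
    by (auto simp: multisum_term_def r Nsum_def z_def)
  have 0: "multisum_term k l 0 1 n = 0" if "n \<in> {1..k-1} \<rightarrow>\<^sub>E UNIV" "n \<noteq> z" for n
  proof -
    have "\<exists>j\<in>{1..k-1}. n j \<noteq> 0"
    proof (rule ccontr)
      assume "\<not> ?thesis"
      then have "n = z" using that(1) by (auto simp: z_def PiE_def extensional_def fun_eq_iff)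
      with that(2) show False ..
    qed
    then obtain j where j: "j \<in> {1..k-1}" "n j \<noteq> 0" ..
    then have "0 < (Nsum k n j)\<^sup>2" by (simp add: Nsum_rec)
    also have "(Nsum k n j)\<^sup>2 \<le> (\<Sum>j = 1..k-1. (Nsum k n j)\<^sup>2 + 2 * l (k - 1 - j) * Nsum k n j)"
      by (rule order_trans[OF le_add1 member_le_sum[OF j(1)]]) auto
    finally show ?thesis by (simp add: multisum_term_def)
  qed
  have "(multisum_term k l 0 1 has_sum 1) {z}"
    using has_sum_finite[of "{z}" "multisum_term k l 0 1"] z by simp
  moreover have "(multisum_term k l 0 1 has_sum 1) {z} = (multisum_term k l 0 1 has_sum 1) ({1..k-1} \<rightarrow>\<^sub>E UNIV)"
    by (rule has_sum_cong_neutral) (use 0 in \<open>auto simp: z_def\<close>)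
  ultimately show ?thesis by simp
qed

theorem theorem1p5:
  fixes k a :: nat and q :: complex
  assumes "k \<ge> a" and "a \<ge> 1" and "k mod 2 \<noteq> a mod 2" and "norm q < 1"
  shows "((\<lambda>n.
            q ^ ((\<Sum>i = 1..k-1. (Nsum k n i)\<^sup>2) + (\<Sum>i | i \<in> {a..k-1} \<and> even (i - a). 2 * Nsum k n i))
              * qpoch (- q) (q\<^sup>2) (n (k-1))
            / ((\<Prod>i = 1..k-2. qpoch (q\<^sup>2) (q\<^sup>2) (n i)) * qpoch (q^4) (q^4) (n (k-1))))
          has_sum
          (qpoch_inf (- q) (q\<^sup>2)
              * qpoch_inf_list [q ^ a, q ^ (2*k+2-a), q ^ (2*k+2)] (q ^ (2*k+2))
            / qpoch_inf (q\<^sup>2) (q\<^sup>2)))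
         ({1..k-1} \<rightarrow>\<^sub>E UNIV)"
proof -
  have "k \<noteq> a" using assms(3) by auto
  then have ak: "a + 1 \<le> k" using assms(1) by simp
  then obtain D where k: "k = a + 1 + D" using le_Suc_ex by blast
  have "even D" using assms(3) unfolding k by presburger
  then have D: "even D" "D + 2 \<le> k" "a + D = k - 1"
    using assms(2) by (simp_all add: k)
  have q: "norm q < 1" by fact
  have q2: "norm (q\<^sup>2) < 1" "norm (q ^ 4) < 1" using q by (auto simp: norm_power power_less_one_iff)
  \<comment> \<open>Counted from the inside, i = k-1, k-3, ..., a becomes t = k-1-i = 0, 2, ..., D,
    where D = k-1-a is even by the parity hypothesis.\<close>
  define l where "l t = (if even t \<and> t \<le> D then 1 else 0 :: nat)" for t
  have "q ^ ((\<Sum>i = 1..k-1. (Nsum k n i)\<^sup>2) + (\<Sum>i | i \<in> {a..k-1} \<and> even (i - a). 2 * Nsum k n i))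
              * qpoch (- q) (q\<^sup>2) (n (k-1))
            / ((\<Prod>i = 1..k-2. qpoch (q\<^sup>2) (q\<^sup>2) (n i)) * qpoch (q^4) (q^4) (n (k-1)))
      = multisum_term k l q 1 n" for n
  proof -
    have "(\<Sum>i | i \<in> {a..k-1} \<and> even (i - a). 2 * Nsum k n i)
       = (\<Sum>i | i \<in> {1..k-1} \<and> a \<le> i \<and> even (i - a). 2 * Nsum k n i)"
      using assms(2) by (intro sum.cong) auto
    also have "\<dots> = (\<Sum>i = 1..k-1. if a \<le> i \<and> even (i - a) then 2 * Nsum k n i else 0)"
      by (rule sum.inter_filter) simp
    also have "\<dots> = (\<Sum>i = 1..k-1. 2 * l (k - 1 - i) * Nsum k n i)"
    proof (rule sum.cong)
      fix i assume i: "i \<in> {1..k-1}"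
      have "(a \<le> i \<and> even (i - a)) \<longleftrightarrow> (even (k - 1 - i) \<and> k - 1 - i \<le> D)"
      proof (cases "a \<le> i")
        case True
        then obtain c where c: "i = a + c" using le_Suc_ex by blast
        then have e: "k - 1 - i = D - c" "i - a = c" "c \<le> D" using i k by auto
        then have "even (D - c) \<longleftrightarrow> even c" using D(1) by simp
        then show ?thesis unfolding e(1,2) using True by simp
      next
        case False
        then have "\<not> k - 1 - i \<le> D" using k by linarith
        with False show ?thesis by blast
      qed
      then show "(if a \<le> i \<and> even (i - a) then 2 * Nsum k n i else 0) = 2 * l (k - 1 - i) * Nsum k n i"
        by (simp add: l_def)
    qed simp
    finally have e: "(\<Sum>i = 1..k-1. (Nsum k n i)\<^sup>2) + (\<Sum>i | i \<in> {a..k-1} \<and> even (i - a). 2 * Nsum k n i)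
       = (\<Sum>j = 1..k-1. (Nsum k n j)\<^sup>2 + 2 * l (k - 1 - j) * Nsum k n j)"
      by (simp add: sum.distrib)
    show ?thesis
      unfolding e multisum_term_def using q q2
      by (simp add: qpoch_eq_qprod rfac_of_nat prod_inversef[symmetric] o_def divide_inverse mult_ac)
  qed
  moreover have "(multisum_term k l q 1 has_sum
      (qpoch_inf (- q) (q\<^sup>2) * qpoch_inf_list [q ^ a, q ^ (2*k+2-a), q ^ (2*k+2)] (q ^ (2*k+2))
            / qpoch_inf (q\<^sup>2) (q\<^sup>2))) ({1..k-1} \<rightarrow>\<^sub>E UNIV)"
  proof (cases "q = 0")
    case True
    \<comment> \<open>The exponents a, 2k+2-a and 2k+2 are positive, so every infinite product on
      the right is 1.\<close>
    then show ?thesis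
      using assms ak multisum_term_has_sum_0[of k l] by (simp add: qpoch_inf_list_def power_0_left)
  next
    case False
    \<comment> \<open>The triple product is taken with m = k + 1 and b = D + 2 = k + 1 - a, so m - b
      = a and m + b = 2k + 2 - a.\<close>
    have "q powi (int (k + 1) - int (D + 2)) = q ^ a"
    proof -
      have "int (k + 1) - int (D + 2) = int a" using k by simp
      then show ?thesis by (metis power_int_of_nat)
    qed
    moreover have "q powi (int (k + 1) + int (D + 2)) = q ^ (2 * k + 2 - a)"
    proof -
      have "int (k + 1) + int (D + 2) = int (2 * k + 2 - a)" using D(3) ak by simp
      then show ?thesis by (metis power_int_of_nat)
    qed
    moreover have "2 * (k + 1) = 2 * k + 2" by simp
    ultimately have "(\<Sum>\<^sub>\<infinity>j. (- 1) powi j * q powi (int (k + 1) * j\<^sup>2 + int (D + 2) * j))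
        = qpoch_inf_list [q ^ a, q ^ (2*k+2-a), q ^ (2*k+2)] (q ^ (2*k+2))"
      using jacobi_triple_product[OF q False, of "int (D + 2)" "k + 1"] D(2)
      by (simp add: qpoch_inf_list_def mult_ac)
    then show ?thesis
      using multisum_eq_theta[OF q False _ D(1,2) l_def] D(2) by simp
  qed
  ultimately show ?thesis by (simp only:)
qed

end
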